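(* For every integer $d\geq 3$ the family $\mathcal{F}_d^{\lambda_{d-1}}$ of all elements of $\mathcal{P}_d^{\lambda_{d-1}}$ whose support has non-integer Hausdorff dimension is dense in the metric space $(\mathcal{P}_d^{\lambda_{d-1}},h)$.
   Context: $\lambda_k$ denotes Lebesgue measure on $[0,1]^k$. A Borel probability measure $\mu$ on $[0,1]^d$ is called $d$-stochastic if for every $j\in\{1,\ldots,d\}$ its push-forward under the coordinate projection $\mathbf{x}\mapsto x_j$ is $\lambda_1$. For $j_0 \in \{1,\ldots,d\}$ let $\pi_{-j_0}:[0,1]^d\to[0,1]^{d-1}$ be the projection $(x_1,\ldots,x_d)\mapsto (x_1,\ldots,x_{j_0-1},x_{j_0+1},\ldots,x_d)$. $\mathcal{P}_d^{\lambda_{d-1}}$ denotes the family of all $d$-stochastic measures $\mu$ such that for every $j_0\in\{1,\ldots,d\}$ the push-forward $\mu^{\pi_{-j_0}}$ of $\mu$ under $\pi_{-j_0}$ equals $\lambda_{d-1}$. The support of a measure is its (closed) topological support, and Hausdorff dimension is taken with respect to the Euclidean metric. $h$ is the Hutchinson (Kantorovich-Rubinstein, Wasserstein-1) metric on Borel probability measures on $[0,1]^d$: $$h(\mu,\nu)=\sup\Big\{\int_{[0,1]^d} g\,d\mu-\int_{[0,1]^d} g\,d\nu:\ g:[0,1]^d\to\mathbb{R},\ |g(\mathbf{x})-g(\mathbf{y})|\le \rho(\mathbf{x},\mathbf{y})\ \text{for all } \mathbf{x},\mathbf{y}\Big\},$$ with $\rho$ the Euclidean metric. *)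

theory Defs
  imports "HOL-Probability.Probability"
begin

text \<open>
  Dimension \<open>d\<close> is the cardinality of the index type \<open>'n\<close>; points of \<open>[0,1]\<^sup>d\<close> are elements of
  \<open>cbox 0 1\<close> in \<open>real ^ 'n\<close>, which carries the Euclidean metric.
\<close>

abbreviation unit_cube :: "(real ^ 'n) set"
  where "unit_cube \<equiv> cbox 0 1"

definition cube_borel :: "(real ^ 'n) measure"
  where "cube_borel = restrict_space borel unit_cube"

definition unit_lebesgue :: "real measure"
  where "unit_lebesgue = restrict_space lborel {0..1}"

text \<open>
  The target \<open>[0,1]\<^sup>d\<^sup>-\<^sup>1\<close> of the projection forgetting coordinate \<open>j\<close> is realised as
  the extensional product of \<open>[0,1]\<close> over the remaining coordinates \<open>UNIV - {j}\<close>; Lebesgue measure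
  on it is the product measure.
\<close>

definition proj_drop :: "'n \<Rightarrow> real ^ 'n \<Rightarrow> ('n \<Rightarrow> real)"
  where "proj_drop j x = restrict (\<lambda>i. x $ i) (UNIV - {j})"

definition lebesgue_drop :: "'n::finite \<Rightarrow> ('n \<Rightarrow> real) measure"
  where "lebesgue_drop j = PiM (UNIV - {j}) (\<lambda>_. unit_lebesgue)"

definition borel_prob_on_cube :: "(real ^ 'n) measure \<Rightarrow> bool"
  where "borel_prob_on_cube \<mu> \<longleftrightarrow> prob_space \<mu> \<and> sets \<mu> = sets cube_borel"

definition d_stochastic :: "(real ^ 'n) measure \<Rightarrow> bool"
  where "d_stochastic \<mu> \<longleftrightarrow> borel_prob_on_cube \<mu> \<and>
    (\<forall>j. distr \<mu> unit_lebesgue (\<lambda>x. x $ j) = unit_lebesgue)"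

definition P_lebesgue :: "(real ^ 'n::finite) measure set"
  where "P_lebesgue = {\<mu>. d_stochastic \<mu> \<and>
    (\<forall>j. distr \<mu> (lebesgue_drop j) (proj_drop j) = lebesgue_drop j)}"

definition msupport :: "'a::topological_space measure \<Rightarrow> 'a set"
  where "msupport \<mu> = {x \<in> space \<mu>. \<forall>U. open U \<and> x \<in> U \<longrightarrow> emeasure \<mu> (U \<inter> space \<mu>) > 0}"

text \<open>
  Contribution \<open>(diam U)\<^sup>s\<close> of a covering set, with the usual conventions that the empty set
  contributes \<open>0\<close> and that \<open>0\<^sup>0 = 1\<close> for nonempty sets (whereas \<open>0 powr 0 = 0\<close>).
  The library's \<open>diameter\<close> is only meaningful on bounded sets, so covers are required to be bounded.
\<close>

definition diam_pow :: "real \<Rightarrow> 'a::metric_space set \<Rightarrow> ennreal"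
  where "diam_pow s U =
    (if U = {} then 0 else if s = 0 then 1 else ennreal (diameter U powr s))"

definition hausdorff_premeasure :: "real \<Rightarrow> real \<Rightarrow> 'a::metric_space set \<Rightarrow> ennreal"
  where "hausdorff_premeasure s \<delta> A =
    Inf {(\<Sum>i. diam_pow s (U i)) |U :: nat \<Rightarrow> 'a set.
      A \<subseteq> (\<Union>i. U i) \<and> (\<forall>i. bounded (U i) \<and> diameter (U i) \<le> \<delta>)}"

definition hausdorff_measure :: "real \<Rightarrow> 'a::metric_space set \<Rightarrow> ennreal"
  where "hausdorff_measure s A = (SUP \<delta>\<in>{0<..}. hausdorff_premeasure s \<delta> A)"

definition hausdorff_dim :: "'a::metric_space set \<Rightarrow> ennreal"
  where "hausdorff_dim A = Inf {ennreal s |s. 0 \<le> s \<and> hausdorff_measure s A = 0}"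

text \<open>
  Only the values of the test function \<open>g\<close> on the cube matter. On Borel probability measures on the
  cube the set below is nonempty and bounded above, so \<open>Sup\<close> on the reals is the genuine supremum.
\<close>

definition hutchinson :: "(real ^ 'n) measure \<Rightarrow> (real ^ 'n) measure \<Rightarrow> real"
  where "hutchinson \<mu> \<nu> =
    Sup {(\<integral>x. g x \<partial>\<mu>) - (\<integral>x. g x \<partial>\<nu>) |g. 1-lipschitz_on unit_cube g}"

text \<open>Hausdorff dimensions are nonnegative, so non-integer means not in \<open>\<nat>\<close>; the value
  \<open>\<infinity>\<close> does not occur for subsets of \<open>real ^ 'n\<close>.\<close>

definition F_lebesgue :: "(real ^ 'n::finite) measure set"
  where "F_lebesgue = {\<mu> \<in> P_lebesgue. hausdorff_dim (msupport \<mu>) \<notin> \<nat>}"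

end

theory Submission
  imports Defs
begin

text \<open>
The idea is to replace \<open>\<mu>\<close>, inside every cube of a fine grid, by a shrunken copy of one fixed fractal
measure with the same mass.

The fractal measure is the law of a vector \<open>Y\<close> whose coordinates other than \<open>j0\<close> are independent and
uniform, and whose coordinate \<open>j0\<close> is \<open>Z\<close> minus the sum of the others modulo 1, where \<open>Z\<close> is independent
of them. As adding an independent variable to a uniform one modulo 1 gives a uniform variable, any \<open>d - 1\<close>
coordinates of \<open>Y\<close> are independent and uniform, whatever the law of \<open>Z\<close> is
(\<open>nn_integral_twist_prod\<close>). The coordinate sum of \<open>Y\<close>, on the other hand, is \<open>Z\<close> modulo 1. Letting
\<open>Z\<close> be distributed on a Cantor set of dimension \<open>1 / 2\<close> confines \<open>Y\<close> to a set which locally is the product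
of this Cantor set with \<open>d - 1\<close> intervals.

The Cantor variable is \<open>Z = stretch V\<close> with \<open>V\<close> uniform. The function \<open>stretch\<close> is increasing and expands
distances at least quadratically, so \<open>Z\<close> hits an interval of length \<open>r\<close> with probability of order
\<open>sqrt r\<close> (\<open>emeasure_stretch_near\<close>); and its values on \<open>[0,1]\<close> are covered by \<open>2^k + 1\<close> intervals of
length \<open>1 / 4^k\<close> (\<open>stretch_near_dyadic\<close>).

Given \<open>N\<close>, the measure \<open>patch N j0 \<mu>\<close> is obtained from \<open>X\<close> with law \<open>\<mu>\<close> by keeping the grid cube of \<open>X\<close>
and replacing the position within the cube by an independent copy of \<open>Y\<close>. Its marginals on \<open>d - 1\<close>
coordinates are Lebesgue (\<open>marginal_patch\<close>), and it is within \<open>d / N\<close> of \<open>\<mu>\<close> because points move only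
within their grid cube (\<open>hutchinson_patch_le\<close>). After rescaling by \<open>N\<close> the coordinate sum
of its points still lies in the Cantor set modulo integers, which gives economical covers of the support
(\<open>bands_cover\<close>, \<open>patch_map_in_band\<close>); and it gives a ball of radius \<open>r\<close> mass of order
\<open>r powr (d - 1 / 2)\<close> (\<open>emeasure_patch_cball\<close>), so the mass distribution principle applies. The
dimension of the support is therefore \<open>d - 1 / 2\<close> for every \<open>\<mu>\<close> and every \<open>N\<close>.
\<close>

section \<open>Uniform variables on the unit interval\<close>

lemma space_unit_lebesgue [simp]: "space unit_lebesgue = {0..1}"
  by (simp add: unit_lebesgue_def space_restrict_space)

lemma sets_unit_lebesgueD:
  assumes "A \<in> sets unit_lebesgue" shows "A \<in> sets borel"
  using assms by (auto simp: unit_lebesgue_def sets_restrict_space)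

lemma measurable_unit_lebesgue1:
  assumes "f \<in> measurable borel M" shows "f \<in> measurable unit_lebesgue M"
  unfolding unit_lebesgue_def by (rule measurable_restrict_space1) (use assms in simp)

lemma nn_integral_unit_lebesgue:
  assumes [measurable]: "f \<in> borel_measurable borel"
  shows "(\<integral>\<^sup>+u. f u \<partial>unit_lebesgue) = (\<integral>\<^sup>+u. f u * indicator {0..<1} u \<partial>lborel)"
proof -
  have "(\<integral>\<^sup>+u. f u \<partial>unit_lebesgue) = (\<integral>\<^sup>+u. f u * indicator {0..1} u \<partial>lborel)"
    unfolding unit_lebesgue_def by (rule nn_integral_restrict_space) simp
  also have "\<dots> = (\<integral>\<^sup>+u. f u * indicator {0..<1} u \<partial>lborel)"
    by (rule nn_integral_cong_AE, use AE_lborel_singleton[of 1] in eventually_elim)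
       (auto simp: indicator_def)
  finally show ?thesis .
qed

lemma prob_space_unit_lebesgue: "prob_space unit_lebesgue"
proof
  have "emeasure unit_lebesgue (space unit_lebesgue) = emeasure lborel {0..1::real}"
    unfolding space_unit_lebesgue unfolding unit_lebesgue_def
    by (rule emeasure_restrict_space) auto
  then show "emeasure unit_lebesgue (space unit_lebesgue) = 1" by simp
qed

text \<open>
Reflection and rotation preserve Haar measure on the circle. Concretely, with \<open>t = frac c\<close> the map
\<open>u \<mapsto> frac (c - u)\<close> reflects each of the two arcs \<open>[0, t]\<close> and \<open>(t, 1)\<close> onto itself.
\<close>

lemma nn_integral_frac_reflect:
  fixes f :: "real \<Rightarrow> ennreal"
  assumes [measurable]: "f \<in> borel_measurable borel"
  shows "(\<integral>\<^sup>+u. f (frac (c - u)) \<partial>unit_lebesgue) = (\<integral>\<^sup>+u. f u \<partial>unit_lebesgue)"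
proof -
  define t where "t = frac c"
  have t: "0 \<le> t" "t < 1" by (auto simp: t_def frac_lt_1)
  have ct: "c = t + of_int \<lfloor>c\<rfloor>" by (simp add: t_def frac_def)
  have low: "frac (c - u) = t - u" if "0 \<le> u" "u \<le> t" for u
    using that t by (subst frac_unique_iff) (simp add: t_def frac_def)
  have high: "frac (c - u) = t + 1 - u" if "t < u" "u < 1" for u
  proof -
    have "c - u - (t + 1 - u) = of_int (\<lfloor>c\<rfloor> - 1)" using ct by simp
    then have "c - u - (t + 1 - u) \<in> \<int>" by (metis Ints_of_int)
    then show ?thesis using that t by (subst frac_unique_iff) auto
  qed
  have "(\<integral>\<^sup>+u. f (frac (c - u)) \<partial>unit_lebesgue)
      = (\<integral>\<^sup>+u. f (frac (c - u)) * indicator {0..<1} u \<partial>lborel)"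
    by (rule nn_integral_unit_lebesgue) (simp add: frac_def)
  also have "\<dots> = (\<integral>\<^sup>+u. f (t - u) * indicator {0..t} (t - u)
      + f (t + 1 - u) * indicator {t<..<1} (t + 1 - u) \<partial>lborel)"
    using t by (intro nn_integral_cong) (auto simp: indicator_def low high)
  also have "\<dots> = (\<integral>\<^sup>+u. f (t - u) * indicator {0..t} (t - u) \<partial>lborel)
      + (\<integral>\<^sup>+u. f (t + 1 - u) * indicator {t<..<1} (t + 1 - u) \<partial>lborel)"
    by (rule nn_integral_add) auto
  also have "(\<integral>\<^sup>+u. f (t - u) * indicator {0..t} (t - u) \<partial>lborel)
      = (\<integral>\<^sup>+u. f u * indicator {0..t} u \<partial>lborel)"
    by (subst (2) nn_integral_real_affine[where c = "-1" and t = t]) auto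
  also have "(\<integral>\<^sup>+u. f (t + 1 - u) * indicator {t<..<1} (t + 1 - u) \<partial>lborel)
      = (\<integral>\<^sup>+u. f u * indicator {t<..<1} u \<partial>lborel)"
    by (subst (2) nn_integral_real_affine[where c = "-1" and t = "t + 1"]) auto
  also have "(\<integral>\<^sup>+u. f u * indicator {0..t} u \<partial>lborel)
      + (\<integral>\<^sup>+u. f u * indicator {t<..<1} u \<partial>lborel)
      = (\<integral>\<^sup>+u. f u * indicator {0..t} u + f u * indicator {t<..<1} u \<partial>lborel)"
    by (rule nn_integral_add[symmetric]) auto
  also have "\<dots> = (\<integral>\<^sup>+u. f u * indicator {0..<1} u \<partial>lborel)"
    using t by (intro nn_integral_cong) (auto simp: indicator_def)
  also have "\<dots> = (\<integral>\<^sup>+u. f u \<partial>unit_lebesgue)"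
    by (rule nn_integral_unit_lebesgue[symmetric]) simp
  finally show ?thesis .
qed

text \<open>
The index of the block of length \<open>1 / N\<close> that contains \<open>x\<close>. Capping at \<open>N - 1\<close> puts the endpoint
\<open>x = 1\<close> into the last block, so that \<open>(cell N x + y) / N\<close> never leaves \<open>[0,1]\<close>.
\<close>

definition cell :: "nat \<Rightarrow> real \<Rightarrow> int"
  where "cell N x = min \<lfloor>real N * x\<rfloor> (int N - 1)"

lemma measurable_cell [measurable]: "cell N \<in> measurable borel (count_space UNIV)"
  unfolding cell_def by measurable

lemma cell_bounds:
  assumes "0 < N" "x \<in> {0..1}"
  shows "0 \<le> cell N x" "cell N x < int N"
    "of_int (cell N x) \<le> real N * x" "real N * x \<le> of_int (cell N x) + 1"
proof -
  have "real N * x \<le> real N" using assms by (simp add: mult_left_le)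
  moreover have "0 \<le> real N * x" using assms by simp
  ultimately show "0 \<le> cell N x" "cell N x < int N"
    "of_int (cell N x) \<le> real N * x" "real N * x \<le> of_int (cell N x) + 1"
    using assms unfolding cell_def by (auto simp: min_def floor_le_iff) linarith+
qed

lemma cell_add_bounds:
  assumes "0 < N" "x \<in> {0..1}" "y \<in> {0..1}"
  shows "(of_int (cell N x) + y) / real N \<in> {0..1}"
    "\<bar>x - (of_int (cell N x) + y) / real N\<bar> \<le> 1 / real N"
proof -
  note b = cell_bounds[OF assms(1,2)]
  have "of_int (cell N x) + 1 \<le> real N"
    using b(2) by linarith
  then show "(of_int (cell N x) + y) / real N \<in> {0..1}"
    using b assms by (auto simp: field_simps)
  have "\<bar>real N * x - (of_int (cell N x) + y)\<bar> \<le> 1"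
    using b assms(3) by auto
  moreover have "x - (of_int (cell N x) + y) / real N
      = (real N * x - (of_int (cell N x) + y)) / real N"
    using assms(1) by (simp add: field_simps)
  ultimately show "\<bar>x - (of_int (cell N x) + y) / real N\<bar> \<le> 1 / real N"
    using assms(1) by (simp add: abs_divide divide_right_mono)
qed

lemma indicator_unit_interval_split:
  assumes "0 < N"
  shows "indicator {0..<1} x
    = (\<Sum>k<N. indicator {real k / real N..<(real k + 1) / real N} x :: ennreal)"
proof -
  have "indicator {0..<real n / real N} x
    = (\<Sum>k<n. indicator {real k / real N..<(real k + 1) / real N} x :: ennreal)" for n
  proof (induction n)
    case (Suc n)
    have "real n / real N \<le> (real n + 1) / real N" "0 \<le> real n / real N"
      by (auto intro: divide_right_mono)
    then have "{0..<(real n + 1) / real N}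
        = {0..<real n / real N} \<union> {real n / real N..<(real n + 1) / real N}"
      by (subst ivl_disj_un) auto
    then have "indicator {0..<(real n + 1) / real N} x = (indicator {0..<real n / real N} x
        + indicator {real n / real N..<(real n + 1) / real N} x :: ennreal)"
      by (auto simp: indicator_def)
    with Suc show ?case by (simp add: add.commute)
  qed simp
  from this[of N] assms show ?thesis by simp
qed

lemma cell_on_block:
  assumes "k < N" "x \<in> {real k / real N..<(real k + 1) / real N}"
  shows "cell N x = int k"
proof -
  have "\<lfloor>real N * x\<rfloor> = int k"
    using assms by (intro floor_unique) (auto simp: field_simps)
  with assms(1) show ?thesis by (simp add: cell_def)
qed

text \<open>
Keeping the block of a uniform point and choosing its position inside the block afresh gives a
uniform point again: on both sides the integral is the sum over the blocks of the block averages.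
\<close>

lemma nn_integral_cell_resample:
  fixes f :: "real \<Rightarrow> ennreal"
  assumes N: "0 < N" and [measurable]: "f \<in> borel_measurable borel"
  shows "(\<integral>\<^sup>+x. (\<integral>\<^sup>+v. f ((of_int (cell N x) + v) / real N) \<partial>unit_lebesgue) \<partial>unit_lebesgue)
    = (\<integral>\<^sup>+x. f x \<partial>unit_lebesgue)"
proof -
  define h where "h k = (\<integral>\<^sup>+v. f ((of_int k + v) / real N) \<partial>unit_lebesgue)" for k :: int
  let ?B = "\<lambda>k. {real k / real N..<(real k + 1) / real N}"
  have block: "(\<integral>\<^sup>+x. f x * indicator (?B k) x \<partial>lborel) = h (int k) * emeasure lborel (?B k)" for k
  proof -
    have *: "indicator (?B k) (real k / real N + 1 / real N * x) = (indicator {0..<1} x :: ennreal)"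
      for x using N by (auto simp: indicator_def field_simps)
    have "(\<integral>\<^sup>+x. f x * indicator (?B k) x \<partial>lborel)
      = ennreal (1 / real N) * (\<integral>\<^sup>+x. f (real k / real N + 1 / real N * x)
          * indicator (?B k) (real k / real N + 1 / real N * x) \<partial>lborel)"
      using N by (subst nn_integral_real_affine[where c = "1 / real N" and t = "real k / real N"]) auto
    also have "(\<integral>\<^sup>+x. f (real k / real N + 1 / real N * x)
          * indicator (?B k) (real k / real N + 1 / real N * x) \<partial>lborel) = h (int k)"
      unfolding h_def * by (subst nn_integral_unit_lebesgue) (auto simp: add_divide_distrib)
    also have "ennreal (1 / real N) = emeasure lborel (?B k)"
      by (subst emeasure_lborel_Ico) (auto simp: divide_right_mono simp flip: diff_divide_distrib)
    finally show ?thesis by (simp add: mult.commute)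
  qed
  have "(\<integral>\<^sup>+x. h (cell N x) \<partial>unit_lebesgue) = (\<integral>\<^sup>+x. h (cell N x) * indicator {0..<1} x \<partial>lborel)"
    by (rule nn_integral_unit_lebesgue) simp
  also have "\<dots> = (\<integral>\<^sup>+x. (\<Sum>k<N. h (int k) * indicator (?B k) x) \<partial>lborel)"
  proof (intro nn_integral_cong)
    fix x :: real
    show "h (cell N x) * indicator {0..<1} x = (\<Sum>k<N. h (int k) * indicator (?B k) x)"
      unfolding indicator_unit_interval_split[OF N] sum_distrib_left
      using cell_on_block[of _ N x] by (intro sum.cong refl) (auto simp: indicator_def)
  qed
  also have "\<dots> = (\<Sum>k<N. h (int k) * emeasure lborel (?B k))"
    by (subst nn_integral_sum) (auto simp: nn_integral_cmult)
  also have "\<dots> = (\<Sum>k<N. \<integral>\<^sup>+x. f x * indicator (?B k) x \<partial>lborel)"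
    by (simp only: block)
  also have "\<dots> = (\<integral>\<^sup>+x. (\<Sum>k<N. f x * indicator (?B k) x) \<partial>lborel)"
    by (subst nn_integral_sum) auto
  also have "\<dots> = (\<integral>\<^sup>+x. f x * indicator {0..<1} x \<partial>lborel)"
    by (simp only: indicator_unit_interval_split[OF N] sum_distrib_left)
  also have "\<dots> = (\<integral>\<^sup>+x. f x \<partial>unit_lebesgue)"
    by (rule nn_integral_unit_lebesgue[symmetric]) simp
  finally show ?thesis unfolding h_def .
qed

section \<open>A Cantor measure of dimension one half\<close>

text \<open>
In terms of binary digits \<open>b\<^sub>1, b\<^sub>2, \<dots>\<close> of \<open>u \<in> [0,1)\<close> this is \<open>2 * (\<Sum>n. b\<^sub>n / 4^n)\<close>, so the range
over \<open>[0,1)\<close> is dense in a Cantor set of dimension \<open>1 / 2\<close>, and the image of Lebesgue measure is the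
natural measure of this set. Writing it
with the floors \<open>\<lfloor>2^n u\<rfloor>\<close> instead of the digits makes every single summand monotone in \<open>u\<close>.
\<close>

definition stretch :: "real \<Rightarrow> real"
  where "stretch u = (\<Sum>n. of_int \<lfloor>2 ^ n * u\<rfloor> / 4 ^ n)"

lemma summable_stretch: fixes u :: real shows "summable (\<lambda>n. of_int \<lfloor>2 ^ n * u\<rfloor> / 4 ^ n :: real)"
proof (rule summable_comparison_test')
  show "summable (\<lambda>n. \<bar>u\<bar> * (1/2) ^ n + (1/4 :: real) ^ n)"
    by (intro summable_add summable_mult summable_geometric) auto
  fix n :: nat
  have "\<bar>of_int \<lfloor>2 ^ n * u\<rfloor>\<bar> \<le> \<bar>2 ^ n * u\<bar> + 1" by linarith
  also have "\<dots> = 2 ^ n * \<bar>u\<bar> + 1" by (simp add: abs_mult)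
  finally have "\<bar>of_int \<lfloor>2 ^ n * u\<rfloor>\<bar> / 4 ^ n \<le> (2 ^ n * \<bar>u\<bar> + 1) / (4 ^ n :: real)"
    by (rule divide_right_mono) simp
  also have "\<dots> = \<bar>u\<bar> * (2 ^ n / 4 ^ n) + 1 / 4 ^ n" by (simp add: add_divide_distrib)
  also have "\<dots> = \<bar>u\<bar> * (1/2) ^ n + (1/4) ^ n"
    by (simp add: power_one_over flip: power_divide)
  finally show "norm (of_int \<lfloor>2 ^ n * u\<rfloor> / 4 ^ n :: real) \<le> \<bar>u\<bar> * (1/2) ^ n + (1/4 :: real) ^ n"
    by simp
qed

lemma stretch_diff:
  "stretch v - stretch u = (\<Sum>n. (of_int \<lfloor>2 ^ n * v\<rfloor> - of_int \<lfloor>2 ^ n * u\<rfloor>) / 4 ^ n)"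
  unfolding stretch_def
  by (simp add: suminf_diff[OF summable_stretch summable_stretch] diff_divide_distrib)

lemma summable_stretch_diff:
  fixes u v :: real
  shows "summable (\<lambda>n. (of_int \<lfloor>2 ^ n * v\<rfloor> - of_int \<lfloor>2 ^ n * u\<rfloor>) / 4 ^ n :: real)"
  using summable_diff[OF summable_stretch summable_stretch] by (simp add: diff_divide_distrib)

lemma stretch_term_nonneg:
  "u \<le> v \<Longrightarrow> 0 \<le> (of_int \<lfloor>2 ^ n * v\<rfloor> - of_int \<lfloor>2 ^ n * u\<rfloor>) / (4 ^ n :: real)"
  by (simp add: floor_mono)

lemma mono_stretch: "mono stretch"
proof (rule monoI)
  fix u v :: real assume "u \<le> v"
  then have "0 \<le> stretch v - stretch u"
    unfolding stretch_diff by (intro suminf_nonneg summable_stretch_diff stretch_term_nonneg)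
  then show "stretch u \<le> stretch v" by simp
qed

lemma measurable_stretch [measurable]: "stretch \<in> borel_measurable borel"
  by (rule borel_measurable_mono[OF mono_stretch])

text \<open>
Choose the least \<open>n\<close> with \<open>2^n (v - u) \<ge> 1\<close>. The \<open>n\<close>-th floor then increases by at least one from
\<open>u\<close> to \<open>v\<close>, and as no other summand decreases, the sum grows by at least
\<open>1 / 4^n = (1 / 2^n)\<^sup>2\<close>, while \<open>1 / 2^n \<ge> (v - u) / 2\<close> by minimality, or
by \<open>v - u \<le> 1\<close> in case \<open>n = 0\<close>.
\<close>

lemma stretch_expanding:
  assumes "u \<le> v" "v \<le> u + 1"
  shows "((v - u) / 2)\<^sup>2 \<le> stretch v - stretch u"
proof (cases "u = v")
  case False
  with assms have pos: "0 < v - u" by simp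
  define n where "n = (LEAST n. 1 \<le> 2 ^ n * (v - u))"
  have "\<exists>n. 1 \<le> 2 ^ n * (v - u)"
  proof -
    obtain n where "1 / (v - u) < 2 ^ n" using real_arch_pow[of 2 "1 / (v - u)"] by auto
    with pos show ?thesis by (intro exI[of _ n]) (simp add: field_simps)
  qed
  then have n: "1 \<le> 2 ^ n * (v - u)" unfolding n_def by (rule LeastI_ex)
  have small: "2 ^ n * (v - u) \<le> 2"
  proof (cases n)
    case (Suc m)
    then have "\<not> 1 \<le> 2 ^ m * (v - u)" using not_less_Least[of m "\<lambda>n. 1 \<le> 2 ^ n * (v - u)"] by (simp add: n_def)
    then show ?thesis unfolding Suc by simp
  qed (use assms in simp)
  then have "(v - u) / 2 \<le> 1 / 2 ^ n" by (simp add: field_simps)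
  then have "((v - u) / 2)\<^sup>2 \<le> (1 / 2 ^ n)\<^sup>2" using pos by (intro power_mono) auto
  also have "\<dots> = 1 / 4 ^ n"
    by (simp add: power_divide power_mult[symmetric] mult.commute[of n]) (simp add: power_mult)
  also have "\<dots> \<le> (of_int \<lfloor>2 ^ n * v\<rfloor> - of_int \<lfloor>2 ^ n * u\<rfloor>) / 4 ^ n"
  proof (rule divide_right_mono)
    have "2 ^ n * u + 1 \<le> 2 ^ n * v" using n by (simp add: algebra_simps)
    then have "\<lfloor>2 ^ n * u\<rfloor> + 1 \<le> \<lfloor>2 ^ n * v\<rfloor>" by linarith
    then show "1 \<le> of_int \<lfloor>2 ^ n * v\<rfloor> - (of_int \<lfloor>2 ^ n * u\<rfloor> :: real)" by linarith
  qed simp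
  also have "\<dots> \<le> stretch v - stretch u"
    unfolding stretch_diff
    using sum_le_suminf[OF summable_stretch_diff, of "{n}" v u] stretch_term_nonneg[OF assms(1)]
    by simp
  finally show ?thesis .
qed simp

lemma stretch_range:
  assumes "u \<in> {0..1}" shows "stretch u \<in> {0..2}"
proof -
  have s: "(\<lambda>n. (1/2) ^ n :: real) sums 2" using geometric_sums[of "1/2::real"] by simp
  have le: "of_int \<lfloor>2 ^ n * u\<rfloor> / 4 ^ n \<le> (1/2 :: real) ^ n" for n
  proof -
    have "2 ^ n * u \<le> 2 ^ n" using assms by (simp add: mult_left_le)
    then have "of_int \<lfloor>2 ^ n * u\<rfloor> \<le> (2 ^ n :: real)" by linarith
    then have "of_int \<lfloor>2 ^ n * u\<rfloor> / 4 ^ n \<le> (2 ^ n / 4 ^ n :: real)" by (rule divide_right_mono) simp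
    also have "\<dots> = (1/2) ^ n" by (simp flip: power_divide)
    finally show ?thesis .
  qed
  have "stretch u \<le> 2"
    using suminf_le[OF le summable_stretch sums_summable[OF s]] sums_unique[OF s]
    by (simp add: stretch_def)
  moreover have "0 \<le> stretch u"
    unfolding stretch_def using assms by (intro suminf_nonneg summable_stretch) simp
  ultimately show ?thesis by simp
qed

text \<open>
Rounding \<open>u\<close> down to a multiple of \<open>1 / 2^k\<close> changes no summand up to the \<open>k\<close>-th, and the
\<open>n\<close>-th summand with \<open>n > k\<close> by at most \<open>2^(n-k) / 4^n\<close>. Hence the range over \<open>[0,1]\<close> is covered by
\<open>2^k + 1\<close> intervals of length \<open>1 / 4^k\<close>, which bounds its dimension from above by \<open>1 / 2\<close>.
\<close>

lemma stretch_near_dyadic: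
  fixes u :: real and k :: nat
  defines "a \<equiv> of_int \<lfloor>2 ^ k * u\<rfloor> / 2 ^ k"
  shows "stretch u \<in> {stretch a..stretch a + 1 / 4 ^ k}"
proof -
  have au: "a \<le> u" unfolding a_def by (simp add: divide_le_eq mult.commute)
  \<comment> \<open>\<open>g\<close> dominates the differences of the summands and has sum \<open>1 / 4 ^ k\<close>.\<close>
  define g :: "nat \<Rightarrow> real" where "g n = (if n \<le> k then 0 else 2 ^ (n - k) / 4 ^ n)" for n
  have "(\<lambda>n. (1 / 4 ^ k / 2) * (1/2) ^ n :: real) sums (1 / 4 ^ k / 2 * (1 / (1 - 1/2)))"
    by (intro sums_mult geometric_sums) simp
  moreover have "g (n + Suc k) = (1 / 4 ^ k / 2) * (1/2) ^ n" for n
  proof -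
    have "g (n + Suc k) = 2 * 2 ^ n / (4 * 4 ^ n * 4 ^ k)" by (simp add: g_def power_add)
    also have "\<dots> = (1 / 4 ^ k / 2) * (2 ^ n / 4 ^ n)" by (simp add: field_simps)
    also have "2 ^ n / 4 ^ n = (1/2 :: real) ^ n" by (simp flip: power_divide)
    finally show ?thesis .
  qed
  ultimately have "(\<lambda>n. g (n + Suc k)) sums (1 / 4 ^ k)" by simp
  moreover have "(\<Sum>i<Suc k. g i) = 0" by (rule sum.neutral) (simp add: g_def)
  ultimately have g: "g sums (1 / 4 ^ k)" using sums_iff_shift'[of g "Suc k" "1 / 4 ^ k"] by simp
  have le: "(of_int \<lfloor>2 ^ n * u\<rfloor> - of_int \<lfloor>2 ^ n * a\<rfloor>) / 4 ^ n \<le> g n" for n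
  proof (cases "n \<le> k")
    case True
    have p: "(2::real) ^ k = 2 ^ n * 2 ^ (k - n)" using True by (simp flip: power_add)
    have "\<lfloor>2 ^ n * u\<rfloor> = \<lfloor>2 ^ k * u / of_int (2 ^ (k - n))\<rfloor>" by (simp add: p)
    also have "\<dots> = \<lfloor>2 ^ k * u\<rfloor> div 2 ^ (k - n)" by (rule floor_divide_real_eq_div) simp
    also have "\<dots> = \<lfloor>of_int \<lfloor>2 ^ k * u\<rfloor> / of_int (2 ^ (k - n)) :: real\<rfloor>"
      by (rule floor_divide_of_int_eq[symmetric])
    also have "of_int \<lfloor>2 ^ k * u\<rfloor> / of_int (2 ^ (k - n)) = 2 ^ n * a"
      by (simp add: a_def p)
    finally show ?thesis using True by (simp add: g_def)
  next
    case False
    have p: "(2::real) ^ n = 2 ^ k * 2 ^ (n - k)" using False by (simp flip: power_add)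
    have a: "2 ^ n * a = of_int (2 ^ (n - k) * \<lfloor>2 ^ k * u\<rfloor>)" by (simp add: a_def p)
    have "2 ^ n * u = 2 ^ (n - k) * (2 ^ k * u)" by (simp add: p)
    also have "\<dots> \<le> 2 ^ (n - k) * (of_int \<lfloor>2 ^ k * u\<rfloor> + 1)"
      by (intro mult_left_mono) (linarith, simp)
    finally have "2 ^ n * u \<le> 2 ^ n * a + 2 ^ (n - k)" unfolding a by (simp add: algebra_simps)
    then have "of_int \<lfloor>2 ^ n * u\<rfloor> - of_int \<lfloor>2 ^ n * a\<rfloor> \<le> (2 ^ (n - k) :: real)"
      unfolding a floor_of_int by linarith
    then show ?thesis using False by (simp add: g_def divide_right_mono)
  qed
  have "stretch u - stretch a \<le> 1 / 4 ^ k"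
    unfolding stretch_diff
    using suminf_le[OF le summable_stretch_diff sums_summable[OF g]] sums_unique[OF g] by simp
  moreover have "stretch a \<le> stretch u" using au by (rule monoD[OF mono_stretch])
  ultimately show ?thesis by simp
qed

text \<open>
By quadratic expansion the set in question has diameter at most \<open>sqrt (8 * r)\<close>. This is the
\<open>1 / 2\<close>-Hoelder bound for the Cantor measure on which the lower bound for the dimension rests.
\<close>

lemma emeasure_stretch_near:
  assumes "0 \<le> r"
  shows "emeasure unit_lebesgue {v \<in> {0..1}. \<bar>stretch v - t\<bar> \<le> r} \<le> ennreal (2 * sqrt (8 * r))"
proof (cases "{v \<in> {0..1}. \<bar>stretch v - t\<bar> \<le> r} = {}")
  case False
  let ?A = "{v \<in> {0..1}. \<bar>stretch v - t\<bar> \<le> r}"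
  from False obtain w where w: "w \<in> {0..1}" "\<bar>stretch w - t\<bar> \<le> r" by blast
  have near: "\<bar>v - w\<bar> \<le> sqrt (8 * r)" if v: "v \<in> ?A" for v
  proof (rule real_le_rsqrt)
    have "((v - w) / 2)\<^sup>2 \<le> \<bar>stretch v - stretch w\<bar>"
      using stretch_expanding[of v w] stretch_expanding[of w v] v w
      by (cases "v \<le> w") (auto simp: power2_commute[of v w] power_divide abs_if)
    also have "\<dots> \<le> 2 * r" using v w by auto
    finally show "\<bar>v - w\<bar>\<^sup>2 \<le> 8 * r" by (simp add: power_divide)
  qed
  have A: "?A \<in> sets borel" by measurable
  have "emeasure unit_lebesgue ?A = emeasure lborel ?A"
    unfolding unit_lebesgue_def by (rule emeasure_restrict_space) auto
  also have "\<dots> \<le> emeasure lborel {w - sqrt (8 * r)..w + sqrt (8 * r)}"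
  proof (rule emeasure_mono)
    show "?A \<subseteq> {w - sqrt (8 * r)..w + sqrt (8 * r)}"
    proof
      fix v assume "v \<in> ?A"
      from near[OF this] show "v \<in> {w - sqrt (8 * r)..w + sqrt (8 * r)}" by auto
    qed
  qed simp
  also have "\<dots> = ennreal (2 * sqrt (8 * r))" using assms by simp
  finally show ?thesis .
next
  case True
  show ?thesis unfolding True by simp
qed

section \<open>A fractal measure with uniform marginals\<close>

lemma measurable_frac [measurable]: "(frac :: real \<Rightarrow> real) \<in> borel_measurable borel"
proof -
  have "(\<lambda>x::real. x - of_int \<lfloor>x\<rfloor>) \<in> borel_measurable borel" by measurable
  then show ?thesis by (simp add: frac_def[abs_def])
qed

abbreviation uniform_vector :: "('n::finite \<Rightarrow> real) measure"
  where "uniform_vector \<equiv> PiM UNIV (\<lambda>_. unit_lebesgue)"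

interpretation unit_lebesgue: prob_space unit_lebesgue
  by (rule prob_space_unit_lebesgue)

lemma emeasure_unit_lebesgue_space [simp]: "emeasure unit_lebesgue {0..1} = 1"
  using unit_lebesgue.emeasure_space_1 by simp

interpretation unit_lebesgue_product: product_sigma_finite "\<lambda>_. unit_lebesgue"
  by unfold_locales

text \<open>
The random vector behind the construction, as a function of a uniform vector \<open>u\<close>. The entry \<open>u j0\<close> is
spent on the Cantor variable \<open>stretch (u j0)\<close>, and the coordinate \<open>j0\<close> is then adjusted so that the sum
of all coordinates equals this variable modulo 1.
\<close>

definition twist :: "'n::finite \<Rightarrow> ('n \<Rightarrow> real) \<Rightarrow> 'n \<Rightarrow> real"
  where "twist j0 u i = (if i = j0 then frac (stretch (u j0) - (\<Sum>k\<in>UNIV - {j0}. u k)) else u i)"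

lemma measurable_unit_lebesgue_borel: "(\<lambda>x. x) \<in> borel_measurable unit_lebesgue"
  by (rule measurable_unit_lebesgue1) simp

lemma measurable_coordinate_borel:
  assumes "i \<in> I" shows "(\<lambda>u. u i) \<in> borel_measurable (PiM I (\<lambda>_. unit_lebesgue))"
  by (rule measurable_compose[OF measurable_component_singleton[OF assms]
        measurable_unit_lebesgue_borel])

lemma measurable_twist [measurable]: "(\<lambda>u. twist j0 u i) \<in> borel_measurable uniform_vector"
proof (cases "i = j0")
  case True
  have "(\<lambda>u. stretch (u j0)) \<in> borel_measurable uniform_vector"
    by (rule measurable_compose[OF measurable_coordinate_borel measurable_stretch]) simp
  moreover have "(\<lambda>u. \<Sum>k\<in>UNIV - {j0}. u k) \<in> borel_measurable uniform_vector"
    by (intro borel_measurable_sum measurable_coordinate_borel) simp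
  ultimately have "(\<lambda>u. stretch (u j0) - (\<Sum>k\<in>UNIV - {j0}. u k)) \<in> borel_measurable uniform_vector"
    by (rule borel_measurable_diff)
  from measurable_compose[OF this measurable_frac] True show ?thesis by (simp add: twist_def)
next
  case False
  then show ?thesis using measurable_coordinate_borel[of i UNIV] by (simp add: twist_def)
qed

text \<open>
After dropping coordinate \<open>j\<close> the twisted vector is uniform. For \<open>j = j0\<close> nothing but untouched
coordinates is left. For \<open>j \<noteq> j0\<close> the variable \<open>u j\<close> occurs in coordinate \<open>j0\<close> alone, in the form
\<open>frac (c - u j)\<close> with \<open>c\<close> depending on the other variables, so integrating over \<open>u j\<close> first makes
coordinate \<open>j0\<close> uniform whatever \<open>c\<close> is.
\<close>

lemma nn_integral_twist_prod:
  fixes g :: "'n::finite \<Rightarrow> real \<Rightarrow> ennreal"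
  assumes [measurable]: "\<And>i. g i \<in> borel_measurable borel"
  shows "(\<integral>\<^sup>+u. (\<Prod>i\<in>UNIV - {j}. g i (twist j0 u i)) \<partial>uniform_vector)
    = (\<Prod>i\<in>UNIV - {j}. \<integral>\<^sup>+v. g i v \<partial>unit_lebesgue)"
proof -
  \<comment> \<open>\<open>h\<close> is what remains of the factors once the variable \<open>u j\<close> has been integrated out.\<close>
  define h where "h i = (if i = j0 then \<lambda>_. \<integral>\<^sup>+v. g j0 v \<partial>unit_lebesgue else g i)" for i
  have [measurable]: "h i \<in> borel_measurable unit_lebesgue" for i
    unfolding h_def by (auto intro: measurable_unit_lebesgue1)
  have inner: "(\<integral>\<^sup>+v. (\<Prod>i\<in>UNIV - {j}. g i (twist j0 (x(j := v)) i)) \<partial>unit_lebesgue)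
      = (\<Prod>i\<in>UNIV - {j}. h i (x i))" for x :: "'n \<Rightarrow> real"
  proof (cases "j = j0")
    case True
    then have "(\<Prod>i\<in>UNIV - {j}. g i (twist j0 (x(j := v)) i)) = (\<Prod>i\<in>UNIV - {j}. h i (x i))" for v
      by (intro prod.cong) (auto simp: twist_def h_def)
    then show ?thesis by (simp add: emeasure_unit_lebesgue_space)
  next
    case False
    define R where "R = (\<Prod>i\<in>UNIV - {j} - {j0}. h i (x i))"
    define c where "c = stretch (x j0) - (\<Sum>k\<in>UNIV - {j0} - {j}. x k)"
    have "(\<Prod>i\<in>UNIV - {j}. g i (twist j0 (x(j := v)) i)) = g j0 (frac (c - v)) * R" for v
    proof -
      have s: "(\<Sum>k\<in>UNIV - {j0}. (x(j := v)) k) = v + (\<Sum>k\<in>UNIV - {j0} - {j}. x k)"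
        using False by (subst sum.remove[of _ j]) auto
      have "twist j0 (x(j := v)) j0 = frac (c - v)"
        unfolding twist_def s using False by (simp add: c_def algebra_simps)
      then show ?thesis
        using False unfolding R_def
        by (subst prod.remove[of _ j0]) (auto intro!: prod.cong simp: twist_def h_def)
    qed
    moreover have "(\<integral>\<^sup>+v. g j0 (frac (c - v)) * R \<partial>unit_lebesgue)
        = (\<integral>\<^sup>+v. g j0 v \<partial>unit_lebesgue) * R"
      by (subst nn_integral_multc)
         (auto simp: nn_integral_frac_reflect intro!: measurable_unit_lebesgue1)
    moreover have "(\<Prod>i\<in>UNIV - {j}. h i (x i)) = (\<integral>\<^sup>+v. g j0 v \<partial>unit_lebesgue) * R"
      using False unfolding R_def by (subst prod.remove[of _ j0]) (auto simp: h_def)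
    ultimately show ?thesis by simp
  qed
  have meas: "(\<lambda>u. \<Prod>i\<in>UNIV - {j}. g i (twist j0 u i)) \<in> borel_measurable uniform_vector"
    by measurable
  have ins: "insert j (UNIV - {j}) = UNIV" by auto
  have "(\<integral>\<^sup>+u. (\<Prod>i\<in>UNIV - {j}. g i (twist j0 u i)) \<partial>uniform_vector)
      = (\<integral>\<^sup>+x. (\<Prod>i\<in>UNIV - {j}. h i (x i)) \<partial>PiM (UNIV - {j}) (\<lambda>_. unit_lebesgue))"
    using unit_lebesgue_product.product_nn_integral_insert[of "UNIV - {j}" j
        "\<lambda>u. \<Prod>i\<in>UNIV - {j}. g i (twist j0 u i)"] meas
    unfolding ins inner by simp
  also have "\<dots> = (\<Prod>i\<in>UNIV - {j}. \<integral>\<^sup>+v. h i v \<partial>unit_lebesgue)"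
    by (rule unit_lebesgue_product.product_nn_integral_prod) auto
  also have "\<dots> = (\<Prod>i\<in>UNIV - {j}. \<integral>\<^sup>+v. g i v \<partial>unit_lebesgue)"
    by (intro prod.cong) (auto simp: h_def emeasure_unit_lebesgue_space)
  finally show ?thesis .
qed

lemma space_uniform_vector: "u \<in> space uniform_vector \<longleftrightarrow> (\<forall>i. u i \<in> {0..1})"
  by (auto simp: space_PiM PiE_def Pi_def)

lemma twist_range:
  assumes "u \<in> space uniform_vector" shows "twist j0 u i \<in> {0..1}"
  using assms less_imp_le[OF frac_lt_1] unfolding space_uniform_vector twist_def by auto

lemma sum_twist:
  fixes u :: "'n::finite \<Rightarrow> real"
  assumes "u \<in> space uniform_vector"
  obtains m :: int where "m \<in> {-2..int CARD('n)}" "(\<Sum>i\<in>UNIV. twist j0 u i) = stretch (u j0) + m"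
proof
  let ?s = "\<Sum>k\<in>UNIV - {j0}. u k"
  let ?m = "- \<lfloor>stretch (u j0) - ?s\<rfloor>"
  have "(\<Sum>i\<in>UNIV. twist j0 u i) = twist j0 u j0 + (\<Sum>i\<in>UNIV - {j0}. twist j0 u i)"
    by (subst sum.remove[of _ j0]) auto
  also have "(\<Sum>i\<in>UNIV - {j0}. twist j0 u i) = ?s" by (intro sum.cong) (auto simp: twist_def)
  also have "twist j0 u j0 + ?s = stretch (u j0) + ?m" by (simp add: twist_def frac_def)
  finally show "(\<Sum>i\<in>UNIV. twist j0 u i) = stretch (u j0) + ?m" .
  have u: "u i \<in> {0..1}" for i using assms unfolding space_uniform_vector by blast
  have "0 \<le> ?s" by (intro sum_nonneg) (use u in auto)
  moreover have "?s \<le> (\<Sum>k\<in>UNIV - {j0}. 1)" by (intro sum_mono) (use u in auto)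
  then have "?s \<le> real CARD('n)" by (simp add: card_Diff_singleton of_nat_diff)
  moreover have "stretch (u j0) \<in> {0..2}" by (rule stretch_range[OF u])
  ultimately show "?m \<in> {-2..int CARD('n)}" by (auto; linarith)
qed

lemma emeasure_unit_lebesgue_interval:
  assumes "0 \<le> r" shows "emeasure unit_lebesgue {v \<in> {0..1}. \<bar>v - t\<bar> \<le> r} \<le> ennreal (2 * r)"
proof -
  have "emeasure unit_lebesgue {v \<in> {0..1}. \<bar>v - t\<bar> \<le> r} = emeasure lborel {v \<in> {0..1}. \<bar>v - t\<bar> \<le> r}"
    unfolding unit_lebesgue_def by (rule emeasure_restrict_space) auto
  also have "\<dots> \<le> emeasure lborel {t - r..t + r}" by (rule emeasure_mono) auto
  also have "\<dots> = ennreal (2 * r)" using assms by simp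
  finally show ?thesis .
qed

text \<open>
The law of the twisted vector gives a cube of side \<open>2 * r\<close> mass of order
\<open>r ^ (d - 1) * sqrt r\<close>. If \<open>twist j0 u\<close> is within \<open>r\<close> of \<open>y\<close> in each coordinate, then its coordinate sum
is within \<open>d * r\<close> of that of \<open>y\<close>, so \<open>stretch (u j0)\<close> lies within \<open>d * r\<close> of one of the \<open>d + 3\<close> numbers
\<open>(\<Sum>k. y k) - m\<close>. The coordinates of \<open>u\<close> being independent, this costs a factor of order \<open>sqrt r\<close>,
and each coordinate other than \<open>j0\<close> costs a factor \<open>2 * r\<close>.
\<close>

lemma emeasure_twist_near:
  fixes y :: "'n::finite \<Rightarrow> real"
  assumes r: "0 \<le> r"
  shows "emeasure uniform_vector {u \<in> space uniform_vector. \<forall>i. \<bar>twist j0 u i - y i\<bar> \<le> r}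
    \<le> ennreal (real (CARD('n) + 3) * (2 * sqrt (8 * (real CARD('n) * r)) * (2 * r) ^ (CARD('n) - 1)))"
    (is "emeasure ?P ?E \<le> _")
proof -
  let ?d = "CARD('n)"
  let ?M = "{- 2..int ?d}"
  define A where "A m i = (if i = j0
      then {v \<in> {0..1}. \<bar>stretch v - ((\<Sum>k\<in>UNIV. y k) - of_int m)\<bar> \<le> real ?d * r}
      else {v \<in> {0..1}. \<bar>v - y i\<bar> \<le> r})" for m :: int and i
  have borel_unit: "B \<in> sets unit_lebesgue" if "B \<in> sets borel" "B \<subseteq> {0..1}" for B
    using that unfolding unit_lebesgue_def by (subst sets_restrict_space_iff) auto
  have [measurable]: "A m i \<in> sets unit_lebesgue" for m i
    unfolding A_def by (rule borel_unit) auto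
  have [measurable]: "Pi\<^sub>E UNIV (A m) \<in> sets ?P" for m
    by (intro sets_PiM_I_finite) auto
  have "?E \<subseteq> (\<Union>m\<in>?M. Pi\<^sub>E UNIV (A m))"
  proof
    fix u assume u: "u \<in> ?E"
    then obtain m where m: "m \<in> ?M" "(\<Sum>i\<in>UNIV. twist j0 u i) = stretch (u j0) + of_int m"
      using sum_twist by blast
    have "\<bar>stretch (u j0) - ((\<Sum>k\<in>UNIV. y k) - of_int m)\<bar> = \<bar>\<Sum>i\<in>UNIV. twist j0 u i - y i\<bar>"
      using m(2) by (simp add: sum_subtractf)
    also have "\<dots> \<le> (\<Sum>i\<in>UNIV. \<bar>twist j0 u i - y i\<bar>)" by (rule sum_abs)
    also have "\<dots> \<le> (\<Sum>i\<in>(UNIV::'n set). r)" using u by (intro sum_mono) simp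
    finally have "\<bar>stretch (u j0) - ((\<Sum>k\<in>UNIV. y k) - of_int m)\<bar> \<le> real ?d * r" by simp
    moreover have "\<bar>u i - y i\<bar> \<le> r" if "i \<noteq> j0" for i
    proof -
      have "\<bar>twist j0 u i - y i\<bar> \<le> r" using u by blast
      then show ?thesis using that by (simp add: twist_def)
    qed
    moreover have "u i \<in> {0..1}" for i using u unfolding space_uniform_vector by blast
    ultimately have "u \<in> Pi\<^sub>E UNIV (A m)" by (auto simp: PiE_iff A_def)
    with m(1) show "u \<in> (\<Union>m\<in>?M. Pi\<^sub>E UNIV (A m))" by blast
  qed
  then have "emeasure ?P ?E \<le> emeasure ?P (\<Union>m\<in>?M. Pi\<^sub>E UNIV (A m))"
    by (rule emeasure_mono) measurable
  also have "\<dots> \<le> (\<Sum>m\<in>?M. emeasure ?P (Pi\<^sub>E UNIV (A m)))"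
    by (rule emeasure_subadditive_finite) auto
  also have "\<dots> \<le> (\<Sum>m\<in>?M. ennreal (2 * sqrt (8 * (real ?d * r)) * (2 * r) ^ (?d - 1)))"
  proof (rule sum_mono)
    fix m
    have "emeasure ?P (Pi\<^sub>E UNIV (A m)) = (\<Prod>i\<in>UNIV. emeasure unit_lebesgue (A m i))"
      by (rule unit_lebesgue_product.emeasure_PiM) auto
    also have "\<dots> = emeasure unit_lebesgue (A m j0) * (\<Prod>i\<in>UNIV - {j0}. emeasure unit_lebesgue (A m i))"
      by (subst prod.remove[of _ j0]) auto
    also have "\<dots> \<le> ennreal (2 * sqrt (8 * (real ?d * r))) * (\<Prod>i\<in>UNIV - {j0}. ennreal (2 * r))"
    proof (intro mult_mono prod_mono_ennreal)
      show "emeasure unit_lebesgue (A m j0) \<le> ennreal (2 * sqrt (8 * (real ?d * r)))"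
        using emeasure_stretch_near[of "real ?d * r"] r by (simp add: A_def)
      show "emeasure unit_lebesgue (A m i) \<le> ennreal (2 * r)" if "i \<in> UNIV - {j0}" for i
        using that emeasure_unit_lebesgue_interval[OF r] by (simp add: A_def)
    qed auto
    also have "(\<Prod>i\<in>UNIV - {j0}. ennreal (2 * r)) = ennreal ((2 * r) ^ (?d - 1))"
      using r by (simp add: card_Diff_singleton ennreal_power)
    finally show "emeasure ?P (Pi\<^sub>E UNIV (A m))
        \<le> ennreal (2 * sqrt (8 * (real ?d * r)) * (2 * r) ^ (?d - 1))"
      using r by (simp add: ennreal_mult)
  qed
  also have "\<dots> = ennreal (real (?d + 3) * (2 * sqrt (8 * (real ?d * r)) * (2 * r) ^ (?d - 1)))"
    using r by (simp add: ennreal_mult ennreal_of_nat_eq_real_of_nat nat_add_distrib add.commute)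
  finally show ?thesis .
qed

section \<open>Patching a measure with fractal copies\<close>

definition patch_map :: "nat \<Rightarrow> 'n \<Rightarrow> (real ^ 'n) \<times> ('n \<Rightarrow> real) \<Rightarrow> real ^ 'n::finite"
  where "patch_map N j0 = (\<lambda>(x, u). \<chi> i. (of_int (cell N (x $ i)) + twist j0 u i) / real N)"

text \<open>
The law of \<open>(cell N (X\<^sub>i) + Y\<^sub>i) / N\<close>, where \<open>X\<close> has law \<open>\<mu>\<close> and \<open>Y\<close> is an independent twisted vector:
each cube of the grid of mesh \<open>1 / N\<close> receives a shrunken copy of the law of \<open>Y\<close>, weighted with
the \<open>\<mu>\<close>-mass of the cube.
\<close>

definition patch :: "nat \<Rightarrow> 'n \<Rightarrow> (real ^ 'n::finite) measure \<Rightarrow> (real ^ 'n) measure"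
  where "patch N j0 \<mu> = distr (\<mu> \<Otimes>\<^sub>M uniform_vector) cube_borel (patch_map N j0)"

lemma patch_map_nth:
  "patch_map N j0 p $ i = (of_int (cell N (fst p $ i)) + twist j0 (snd p) i) / real N"
  by (simp add: patch_map_def split_beta)

lemma space_cube_borel [simp]: "space cube_borel = unit_cube"
  by (simp add: cube_borel_def space_restrict_space)

lemma borel_prob_on_cubeD:
  assumes "borel_prob_on_cube \<mu>"
  shows "prob_space \<mu>" "sets \<mu> = sets cube_borel" "space \<mu> = unit_cube"
  using assms sets_eq_imp_space_eq[of \<mu> cube_borel] by (auto simp: borel_prob_on_cube_def)

lemma in_unit_cube_nth: "x \<in> unit_cube \<longleftrightarrow> (\<forall>i. x $ i \<in> {0..1})"
  by (auto simp: mem_box_cart)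

lemma measurable_nth_borel [measurable]: "(\<lambda>x. x $ i) \<in> borel_measurable cube_borel"
  unfolding cube_borel_def
  by (rule measurable_restrict_space1)
     (intro borel_measurable_continuous_onI continuous_intros)

lemma measurable_nth_unit_lebesgue [measurable]: "(\<lambda>x. x $ i) \<in> measurable cube_borel unit_lebesgue"
  unfolding unit_lebesgue_def
  by (rule measurable_restrict_space2) (auto simp: in_unit_cube_nth)

lemma measurable_proj_drop [measurable]: "proj_drop j \<in> measurable cube_borel (lebesgue_drop j)"
  unfolding proj_drop_def[abs_def] lebesgue_drop_def by measurable

text \<open>
Uniform marginals on all coordinates but \<open>j\<close> already determine the one-dimensional ones, since every
coordinate survives the omission of some other one.
\<close>

lemma P_lebesgueI:
  fixes \<nu> :: "(real ^ 'n::finite) measure"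
  assumes d: "CARD('n) \<ge> 2" and prob: "borel_prob_on_cube \<nu>"
    and marginal: "\<And>j. distr \<nu> (lebesgue_drop j) (proj_drop j) = lebesgue_drop j"
  shows "\<nu> \<in> P_lebesgue"
proof -
  note [measurable_cong] = borel_prob_on_cubeD(2)[OF prob]
  have "distr \<nu> unit_lebesgue (\<lambda>x. x $ i) = unit_lebesgue" for i
  proof -
    have "\<exists>j. j \<noteq> i"
    proof (rule ccontr)
      assume "\<nexists>j. j \<noteq> i"
      then have "(UNIV :: 'n set) = {i}" by auto
      then have "CARD('n) = card {i}" by (rule arg_cong)
      with d show False by simp
    qed
    then obtain j where "j \<noteq> i" ..
    then have j: "i \<in> UNIV - {j}" by simp
    have coord: "(\<lambda>f. f i) \<in> measurable (lebesgue_drop j) unit_lebesgue"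
      unfolding lebesgue_drop_def by (rule measurable_component_singleton[OF j])
    have proj: "proj_drop j \<in> measurable \<nu> (lebesgue_drop j)" by measurable
    have "(\<lambda>x :: real ^ 'n. x $ i) = (\<lambda>f. f i) \<circ> proj_drop j"
      using j by (auto simp: proj_drop_def)
    then have "distr \<nu> unit_lebesgue (\<lambda>x. x $ i)
        = distr \<nu> unit_lebesgue ((\<lambda>f. f i) \<circ> proj_drop j)" by (rule arg_cong)
    also have "\<dots> = distr (distr \<nu> (lebesgue_drop j) (proj_drop j)) unit_lebesgue (\<lambda>f. f i)"
      by (rule distr_distr[OF coord proj, symmetric])
    also have "\<dots> = unit_lebesgue"
      unfolding marginal unfolding lebesgue_drop_def
      by (rule distr_PiM_component[OF prob_space_unit_lebesgue j])
    finally show ?thesis .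
  qed
  then show ?thesis using prob marginal by (simp add: P_lebesgue_def d_stochastic_def)
qed

lemma prob_space_uniform_vector: "prob_space (uniform_vector :: ('n::finite \<Rightarrow> real) measure)"
  by (intro prob_space_PiM prob_space_unit_lebesgue)

locale patching =
  fixes N :: nat and j0 :: "'n::finite" and \<mu> :: "(real ^ 'n) measure"
  assumes N: "0 < N" and \<mu>: "\<mu> \<in> P_lebesgue"
begin

lemma prob_cube: "borel_prob_on_cube \<mu>"
  using \<mu> by (simp add: P_lebesgue_def d_stochastic_def)

lemma sets_\<mu> [measurable_cong]: "sets \<mu> = sets cube_borel"
  by (rule borel_prob_on_cubeD(2)[OF prob_cube])

lemma space_\<mu>: "space \<mu> = unit_cube"
  by (rule borel_prob_on_cubeD(3)[OF prob_cube])

sublocale \<mu>: prob_space \<mu>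
  by (rule borel_prob_on_cubeD(1)[OF prob_cube])

sublocale U: prob_space "uniform_vector :: ('n \<Rightarrow> real) measure"
  by (rule prob_space_uniform_vector)

sublocale prod: pair_prob_space \<mu> "uniform_vector :: ('n \<Rightarrow> real) measure" ..

lemma sample_space:
  assumes "p \<in> space (\<mu> \<Otimes>\<^sub>M uniform_vector)"
  shows "fst p \<in> unit_cube" "snd p \<in> space uniform_vector" "fst p $ i \<in> {0..1}"
proof -
  show *: "fst p \<in> unit_cube" "snd p \<in> space uniform_vector"
    using assms by (auto simp: space_pair_measure space_\<mu>)
  from *(1) show "fst p $ i \<in> {0..1}" unfolding in_unit_cube_nth by blast
qed

lemma measurable_patch_map_nth [measurable]:
  "(\<lambda>p. patch_map N j0 p $ i) \<in> borel_measurable (\<mu> \<Otimes>\<^sub>M uniform_vector)"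
proof -
  have "(\<lambda>x. x $ i) \<in> borel_measurable \<mu>" by measurable
  then have 1: "(\<lambda>p. fst p $ i) \<in> borel_measurable (\<mu> \<Otimes>\<^sub>M (uniform_vector :: ('n \<Rightarrow> real) measure))"
    by (rule measurable_compose[OF measurable_fst])
  have 2: "(\<lambda>p. twist j0 (snd p) i) \<in> borel_measurable (\<mu> \<Otimes>\<^sub>M uniform_vector)"
    by (rule measurable_compose[OF measurable_snd measurable_twist])
  have "(\<lambda>t. of_int (cell N t)) \<in> borel_measurable (borel :: real measure)" by measurable
  from measurable_compose[OF 1 this] 2 show ?thesis
    unfolding patch_map_nth by (intro borel_measurable_divide borel_measurable_add) auto
qed

lemma patch_map_in_cube:
  assumes "p \<in> space (\<mu> \<Otimes>\<^sub>M uniform_vector)" shows "patch_map N j0 p \<in> unit_cube"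
  unfolding in_unit_cube_nth patch_map_nth
  using cell_add_bounds(1)[OF N sample_space(3)[OF assms] twist_range[OF sample_space(2)[OF assms]]]
  by blast

lemma measurable_patch_map [measurable]:
  "patch_map N j0 \<in> measurable (\<mu> \<Otimes>\<^sub>M uniform_vector) cube_borel"
  unfolding cube_borel_def
proof (rule measurable_restrict_space2)
  show "patch_map N j0 \<in> space (\<mu> \<Otimes>\<^sub>M uniform_vector) \<rightarrow> unit_cube"
    by (rule Pi_I) (rule patch_map_in_cube)
  show "patch_map N j0 \<in> borel_measurable (\<mu> \<Otimes>\<^sub>M uniform_vector)"
  proof (rule borel_measurable_euclidean_space[THEN iffD2], rule ballI)
    fix b :: "real ^ 'n" assume "b \<in> Basis"
    then obtain i where i: "b = axis i 1" by (auto simp: Basis_vec_def)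
    show "(\<lambda>p. patch_map N j0 p \<bullet> b) \<in> borel_measurable (\<mu> \<Otimes>\<^sub>M uniform_vector)"
      unfolding i cart_eq_inner_axis[symmetric] by (rule measurable_patch_map_nth)
  qed
qed

lemma borel_prob_patch: "borel_prob_on_cube (patch N j0 \<mu>)"
  unfolding borel_prob_on_cube_def patch_def by (simp add: prod.prob_space_distr)

lemma sets_patch [measurable_cong]: "sets (patch N j0 \<mu>) = sets cube_borel"
  by (simp add: patch_def)

lemma space_patch: "space (patch N j0 \<mu>) = unit_cube"
  by (simp add: patch_def)

text \<open>
On a product set the integral over the twisted vector factorises for every fixed \<open>x\<close>, with factors
\<open>G i (x $ i)\<close> in the coordinates \<open>i \<noteq> j\<close>. As \<open>\<mu>\<close> has a Lebesgue marginal on these coordinates, the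
remaining integral factorises too, and each factor is a uniform variable whose position in its block
has been resampled.
\<close>

lemma marginal_patch:
  "distr (patch N j0 \<mu>) (lebesgue_drop j) (proj_drop j) = lebesgue_drop j"
  unfolding lebesgue_drop_def
proof (rule unit_lebesgue_product.PiM_eqI)
  let ?I = "UNIV - {j}" and ?L = "PiM (UNIV - {j}) (\<lambda>_. unit_lebesgue)"
  fix A :: "'n \<Rightarrow> real set"
  assume A: "\<And>i. i \<in> ?I \<Longrightarrow> A i \<in> sets unit_lebesgue"
  \<comment> \<open>The hypothesis constrains \<open>A i\<close> for \<open>i \<noteq> j\<close> only; \<open>B\<close> is measurable at every index.\<close>
  define B where "B i = (if i = j then {} else A i)" for i
  have B [measurable]: "B i \<in> sets borel" for i
    using A sets_unit_lebesgueD[OF A] by (auto simp: B_def)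
  have BA: "B i = A i" if "i \<in> ?I" for i using that by (simp add: B_def)
  define G where "G i t = (\<integral>\<^sup>+v. indicator (B i) ((of_int (cell N t) + v) / real N) \<partial>unit_lebesgue)"
    for i t
  have [measurable]: "G i \<in> borel_measurable borel" for i
  proof -
    have "(\<lambda>k. \<integral>\<^sup>+v. indicator (B i) ((of_int k + v) / real N) \<partial>unit_lebesgue)
        \<in> measurable (count_space (UNIV :: int set)) (borel :: ennreal measure)" by simp
    from measurable_compose[OF measurable_cell this] show ?thesis unfolding G_def .
  qed
  have PA: "Pi\<^sub>E ?I A \<in> sets ?L" by (intro sets_PiM_I_finite A) auto
  have [measurable]: "proj_drop j \<in> measurable cube_borel ?L"
    using measurable_proj_drop[of j] by (simp add: lebesgue_drop_def)
  have "emeasure (distr (patch N j0 \<mu>) ?L (proj_drop j)) (Pi\<^sub>E ?I A)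
      = emeasure (distr (\<mu> \<Otimes>\<^sub>M uniform_vector) ?L (proj_drop j \<circ> patch_map N j0)) (Pi\<^sub>E ?I A)"
    unfolding patch_def by (subst distr_distr) auto
  also have "\<dots> = (\<integral>\<^sup>+f. indicator (Pi\<^sub>E ?I A) f
      \<partial>distr (\<mu> \<Otimes>\<^sub>M uniform_vector) ?L (proj_drop j \<circ> patch_map N j0))"
    using PA by simp
  also have "\<dots> = (\<integral>\<^sup>+p. indicator (Pi\<^sub>E ?I A) (proj_drop j (patch_map N j0 p)) \<partial>(\<mu> \<Otimes>\<^sub>M uniform_vector))"
    by (subst nn_integral_distr) (use PA in auto)
  also have "\<dots> = (\<integral>\<^sup>+p. (\<Prod>i\<in>?I. indicator (B i) (patch_map N j0 p $ i)) \<partial>(\<mu> \<Otimes>\<^sub>M uniform_vector))"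
  proof (intro nn_integral_cong)
    fix p
    show "indicator (Pi\<^sub>E ?I A) (proj_drop j (patch_map N j0 p))
        = (\<Prod>i\<in>?I. indicator (B i) (patch_map N j0 p $ i) :: ennreal)"
    proof (cases "\<forall>i\<in>?I. patch_map N j0 p $ i \<in> A i")
      case True
      then show ?thesis using BA by (auto simp: proj_drop_def indicator_def)
    next
      case False
      then obtain i where i: "i \<in> ?I" "patch_map N j0 p $ i \<notin> B i" using BA by blast
      then have "(\<Prod>i\<in>?I. indicator (B i) (patch_map N j0 p $ i) :: ennreal) = 0"
        by (intro prod_zero bexI[of _ i]) auto
      with False show ?thesis by (auto simp: proj_drop_def indicator_def PiE_iff)
    qed
  qed
  also have "\<dots> = (\<integral>\<^sup>+x. (\<integral>\<^sup>+u. (\<Prod>i\<in>?I. indicator (B i) (patch_map N j0 (x, u) $ i))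
      \<partial>uniform_vector) \<partial>\<mu>)"
    by (rule U.nn_integral_fst[symmetric]) measurable
  also have "\<dots> = (\<integral>\<^sup>+x. (\<Prod>i\<in>?I. G i (x $ i)) \<partial>\<mu>)"
  proof (intro nn_integral_cong)
    fix x :: "real ^ 'n"
    show "(\<integral>\<^sup>+u. (\<Prod>i\<in>?I. indicator (B i) (patch_map N j0 (x, u) $ i)) \<partial>uniform_vector)
        = (\<Prod>i\<in>?I. G i (x $ i))"
      unfolding patch_map_nth fst_conv snd_conv G_def
      by (rule nn_integral_twist_prod[where
            g = "\<lambda>i v. indicator (B i) ((of_int (cell N (x $ i)) + v) / real N)"]) measurable
  qed
  also have "\<dots> = (\<integral>\<^sup>+x. (\<Prod>i\<in>?I. G i (proj_drop j x i)) \<partial>\<mu>)"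
    by (intro nn_integral_cong prod.cong) (auto simp: proj_drop_def)
  also have "\<dots> = (\<integral>\<^sup>+f. (\<Prod>i\<in>?I. G i (f i)) \<partial>distr \<mu> ?L (proj_drop j))"
  proof -
    have "(\<lambda>f. \<Prod>i\<in>?I. G i (f i)) \<in> borel_measurable ?L"
      by (intro borel_measurable_prod_ennreal measurable_compose[OF measurable_coordinate_borel]) auto
    then show ?thesis by (subst nn_integral_distr) auto
  qed
  also have "distr \<mu> ?L (proj_drop j) = ?L"
    using \<mu> by (simp add: P_lebesgue_def lebesgue_drop_def)
  also have "(\<integral>\<^sup>+f. (\<Prod>i\<in>?I. G i (f i)) \<partial>?L) = (\<Prod>i\<in>?I. \<integral>\<^sup>+t. G i t \<partial>unit_lebesgue)"
    by (rule unit_lebesgue_product.product_nn_integral_prod)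
       (auto intro: measurable_unit_lebesgue1)
  also have "\<dots> = (\<Prod>i\<in>?I. emeasure unit_lebesgue (A i))"
  proof (rule prod.cong)
    fix i assume i: "i \<in> ?I"
    have "(\<integral>\<^sup>+t. G i t \<partial>unit_lebesgue) = (\<integral>\<^sup>+t. indicator (B i) t \<partial>unit_lebesgue)"
      unfolding G_def by (rule nn_integral_cell_resample[OF N]) measurable
    then show "(\<integral>\<^sup>+t. G i t \<partial>unit_lebesgue) = emeasure unit_lebesgue (A i)"
      using A[OF i] BA[OF i] by simp
  qed simp
  finally show "emeasure (distr (patch N j0 \<mu>) ?L (proj_drop j)) (Pi\<^sub>E ?I A)
      = (\<Prod>i\<in>?I. emeasure unit_lebesgue (A i))" .
qed auto

lemma patch_in_P_lebesgue:
  assumes "CARD('n) \<ge> 2" shows "patch N j0 \<mu> \<in> P_lebesgue"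
  using assms borel_prob_patch marginal_patch by (rule P_lebesgueI)

lemma dist_patch_map:
  assumes "p \<in> space (\<mu> \<Otimes>\<^sub>M uniform_vector)"
  shows "dist (fst p) (patch_map N j0 p) \<le> real CARD('n) / real N"
proof -
  have "dist (fst p) (patch_map N j0 p) \<le> (\<Sum>i\<in>UNIV. \<bar>(fst p - patch_map N j0 p) $ i\<bar>)"
    unfolding dist_norm by (rule norm_le_l1_cart)
  also have "\<dots> \<le> (\<Sum>i\<in>(UNIV :: 'n set). 1 / real N)"
  proof (rule sum_mono)
    fix i
    show "\<bar>(fst p - patch_map N j0 p) $ i\<bar> \<le> 1 / real N"
      unfolding vector_minus_component patch_map_nth
      by (rule cell_add_bounds(2)[OF N sample_space(3)[OF assms]
            twist_range[OF sample_space(2)[OF assms]]])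
  qed
  finally show ?thesis by simp
qed

text \<open>
The pair of \<open>X\<close> and its patched version is a coupling of \<open>\<mu>\<close> and \<open>patch N j0 \<mu>\<close> whose components are
never further apart than \<open>d / N\<close>, as both lie in the same cube of the grid.
\<close>

lemma hutchinson_patch_le: "hutchinson \<mu> (patch N j0 \<mu>) \<le> real CARD('n) / real N"
  unfolding hutchinson_def
proof (rule cSup_least)
  have "1-lipschitz_on unit_cube (\<lambda>_ :: real ^ 'n. 0 :: real)"
    by (rule lipschitz_onI) auto
  then show "{(\<integral>x. g x \<partial>\<mu>) - (\<integral>x. g x \<partial>patch N j0 \<mu>) |g :: real ^ 'n \<Rightarrow> real. 1-lipschitz_on unit_cube g} \<noteq> {}"
    by (auto intro!: exI[of _ "\<lambda>_. 0"])
  fix c assume "c \<in> {(\<integral>x. g x \<partial>\<mu>) - (\<integral>x. g x \<partial>patch N j0 \<mu>) |g :: real ^ 'n \<Rightarrow> real. 1-lipschitz_on unit_cube g}"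
  then obtain g where g: "1-lipschitz_on unit_cube g"
    and c: "c = (\<integral>x. g x \<partial>\<mu>) - (\<integral>x. g x \<partial>patch N j0 \<mu>)" by blast
  have cont: "continuous_on unit_cube g" by (rule lipschitz_on_continuous_on[OF g])
  then have g_meas [measurable]: "g \<in> borel_measurable cube_borel"
    unfolding cube_borel_def by (rule borel_measurable_continuous_on_restrict)
  have "compact (g ` unit_cube)" by (rule compact_continuous_image[OF cont compact_cbox])
  then have "bounded (g ` unit_cube)" by (rule compact_imp_bounded)
  then obtain b where "\<forall>y \<in> g ` unit_cube. norm y \<le> b" unfolding bounded_iff ..
  then have b: "norm (g x) \<le> b" if "x \<in> unit_cube" for x using that by auto
  have int: "integrable (\<mu> \<Otimes>\<^sub>M uniform_vector) (\<lambda>p. g (f p))"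
    if [measurable]: "f \<in> measurable (\<mu> \<Otimes>\<^sub>M uniform_vector) cube_borel"
      for f :: "(real ^ 'n) \<times> ('n \<Rightarrow> real) \<Rightarrow> real ^ 'n"
    by (rule prod.P.integrable_const_bound[of _ b])
       (use b measurable_space[OF that] in auto)
  have fst [measurable]: "fst \<in> measurable (\<mu> \<Otimes>\<^sub>M uniform_vector) cube_borel"
    using measurable_fst measurable_cong_sets[OF refl sets_\<mu>] by blast
  have "(\<integral>x. g x \<partial>\<mu>) = (\<integral>x. g x \<partial>distr (\<mu> \<Otimes>\<^sub>M (uniform_vector :: ('n \<Rightarrow> real) measure)) \<mu> fst)"
    by (simp only: U.distr_pair_fst)
  also have "\<dots> = (\<integral>p. g (fst p) \<partial>(\<mu> \<Otimes>\<^sub>M (uniform_vector :: ('n \<Rightarrow> real) measure)))"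
    by (rule integral_distr) measurable
  moreover have "(\<integral>x. g x \<partial>patch N j0 \<mu>) = (\<integral>p. g (patch_map N j0 p) \<partial>(\<mu> \<Otimes>\<^sub>M uniform_vector))"
    unfolding patch_def by (rule integral_distr) measurable
  ultimately have "c = (\<integral>p. g (fst p) - g (patch_map N j0 p) \<partial>(\<mu> \<Otimes>\<^sub>M uniform_vector))"
    unfolding c by (subst Bochner_Integration.integral_diff) (auto intro!: int)
  also have "\<dots> \<le> real CARD('n) / real N"
  proof (rule prod.P.integral_le_const)
    show "integrable (\<mu> \<Otimes>\<^sub>M uniform_vector) (\<lambda>p. g (fst p) - g (patch_map N j0 p))"
      by (intro Bochner_Integration.integrable_diff int) measurable
    show "AE p in \<mu> \<Otimes>\<^sub>M uniform_vector. g (fst p) - g (patch_map N j0 p) \<le> real CARD('n) / real N"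
    proof (rule AE_I2)
      fix p assume p: "p \<in> space (\<mu> \<Otimes>\<^sub>M (uniform_vector :: ('n \<Rightarrow> real) measure))"
      have "g (fst p) - g (patch_map N j0 p) \<le> dist (g (fst p)) (g (patch_map N j0 p))"
        by (simp add: dist_real_def)
      also have "\<dots> \<le> 1 * dist (fst p) (patch_map N j0 p)"
        by (rule lipschitz_onD[OF g sample_space(1)[OF p] patch_map_in_cube[OF p]])
      also have "\<dots> \<le> real CARD('n) / real N" using dist_patch_map[OF p] by simp
      finally show "g (fst p) - g (patch_map N j0 p) \<le> real CARD('n) / real N" .
    qed
  qed
  finally show "c \<le> real CARD('n) / real N" .
qed

end

section \<open>Supports and Hausdorff dimension\<close>

text \<open>
The complement of the support is a union of null open sets, and by second countability countably many
of them suffice.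
\<close>

lemma AE_msupport:
  fixes \<nu> :: "'a::second_countable_topology measure"
  assumes sets: "\<And>U. open U \<Longrightarrow> U \<inter> space \<nu> \<in> sets \<nu>"
  shows "AE x in \<nu>. x \<in> msupport \<nu>"
proof -
  obtain \<B> :: "'a set set" where \<B>: "countable \<B>" "topological_basis \<B>"
    using ex_countable_basis by blast
  define \<Z> where "\<Z> = {B \<in> \<B>. emeasure \<nu> (B \<inter> space \<nu>) = 0}"
  have "countable \<Z>" unfolding \<Z>_def by (rule countable_subset[OF _ \<B>(1)]) auto
  moreover have "B \<inter> space \<nu> \<in> null_sets \<nu>" if "B \<in> \<Z>" for B
    using that sets topological_basis_open[OF \<B>(2)] by (auto simp: \<Z>_def null_sets_def)
  ultimately have "(\<Union>B\<in>\<Z>. B \<inter> space \<nu>) \<in> null_sets \<nu>" by (rule null_sets_UN')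
  then show ?thesis
  proof (rule AE_I')
    show "{x \<in> space \<nu>. x \<notin> msupport \<nu>} \<subseteq> (\<Union>B\<in>\<Z>. B \<inter> space \<nu>)"
    proof
      fix x assume "x \<in> {x \<in> space \<nu>. x \<notin> msupport \<nu>}"
      then obtain U where x: "x \<in> space \<nu>" and U: "open U" "x \<in> U" "emeasure \<nu> (U \<inter> space \<nu>) = 0"
        by (auto simp: msupport_def)
      from topological_basisE[OF \<B>(2) U(1,2)] obtain B where B: "B \<in> \<B>" "x \<in> B" "B \<subseteq> U" by blast
      have "emeasure \<nu> (B \<inter> space \<nu>) \<le> emeasure \<nu> (U \<inter> space \<nu>)"
        by (rule emeasure_mono[OF _ sets[OF U(1)]]) (use B in blast)
      with U(3) B x show "x \<in> (\<Union>B\<in>\<Z>. B \<inter> space \<nu>)" by (auto simp: \<Z>_def)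
    qed
  qed
qed

lemma msupport_subset_closed:
  assumes "closed S" "AE x in \<nu>. x \<in> S"
    and sets: "\<And>U. open U \<Longrightarrow> U \<inter> space \<nu> \<in> sets \<nu>"
  shows "msupport \<nu> \<subseteq> S"
proof
  fix x assume x: "x \<in> msupport \<nu>"
  show "x \<in> S"
  proof (rule ccontr)
    assume "x \<notin> S"
    then have "emeasure \<nu> (- S \<inter> space \<nu>) > 0"
      using x assms(1) by (auto simp: msupport_def)
    moreover have "emeasure \<nu> (- S \<inter> space \<nu>) = 0"
      using assms(1,2) sets[of "- S"]
      by (subst AE_iff_measurable[symmetric, where P = "\<lambda>x. x \<in> S"]) auto
    ultimately show False by simp
  qed
qed

text \<open>
The mass distribution principle: a set of diameter \<open>r\<close> lies in a ball of radius \<open>r\<close> around any of its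
points and so has mass at most \<open>C * r powr t\<close>. Any cover carries the total mass 1, hence its sum of
\<open>t\<close>-th powers, and for diameters at most 1 also that of \<open>s\<close>-th powers with \<open>s < t\<close>, is at least
\<open>1 / C\<close>.
\<close>

lemma hausdorff_dim_ge:
  fixes \<nu> :: "'a::metric_space measure"
  assumes "prob_space \<nu>" and A: "AE x in \<nu>. x \<in> A"
    and sets: "\<And>x r. cball x r \<inter> space \<nu> \<in> sets \<nu>"
    and C: "0 < C" and t: "0 < t"
    and ball: "\<And>x r. 0 \<le> r \<Longrightarrow> emeasure \<nu> (cball x r \<inter> space \<nu>) \<le> ennreal (C * r powr t)"
  shows "ennreal t \<le> hausdorff_dim A"
proof -
  interpret prob_space \<nu> by fact
  have pos: "hausdorff_measure s A > 0" if s: "0 \<le> s" "s < t" for s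
  proof -
    have "ennreal (1 / C) \<le> hausdorff_premeasure s 1 A"
      unfolding hausdorff_premeasure_def
    proof (rule Inf_greatest)
      fix z assume "z \<in> {(\<Sum>i. diam_pow s (U i)) |U :: nat \<Rightarrow> 'a set.
        A \<subseteq> (\<Union>i. U i) \<and> (\<forall>i. bounded (U i) \<and> diameter (U i) \<le> 1)}"
      then obtain U :: "nat \<Rightarrow> 'a set" where z: "z = (\<Sum>i. diam_pow s (U i))"
        and U: "A \<subseteq> (\<Union>i. U i)" "\<And>i. bounded (U i)" "\<And>i. diameter (U i) \<le> 1"
        by auto
      define B where "B i = (if U i = {} then {}
        else cball (SOME u. u \<in> U i) (diameter (U i)) \<inter> space \<nu>)" for i
      have B: "B i \<in> sets \<nu>" for i using sets by (simp add: B_def)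
      have UB: "U i \<inter> space \<nu> \<subseteq> B i" for i
      proof
        fix x assume x: "x \<in> U i \<inter> space \<nu>"
        then have "(SOME u. u \<in> U i) \<in> U i" by (rule someI[of _ x, OF IntD1])
        then have "dist (SOME u. u \<in> U i) x \<le> diameter (U i)"
          using x by (intro diameter_bounded_bound[OF U(2)]) auto
        with x show "x \<in> B i" by (auto simp: B_def)
      qed
      have piece: "emeasure \<nu> (B i) \<le> ennreal C * diam_pow s (U i)" for i
      proof (cases "U i = {}")
        case False
        have d: "0 \<le> diameter (U i)" by (rule diameter_ge_0[OF U(2)])
        have "emeasure \<nu> (B i) \<le> ennreal (C * diameter (U i) powr t)"
          using False ball[OF d] by (simp add: B_def)
        also have "\<dots> = ennreal C * ennreal (diameter (U i) powr t)"
          using C by (simp add: ennreal_mult)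
        also have "ennreal (diameter (U i) powr t) \<le> diam_pow s (U i)"
        proof -
          have "diameter (U i) powr t \<le> diameter (U i) powr s"
            using s d U(3) by (intro powr_mono') auto
          moreover have "diameter (U i) powr t \<le> 1"
            using t d U(3) by (intro powr_le1) auto
          ultimately show ?thesis using False by (auto simp: diam_pow_def)
        qed
        finally show ?thesis by (simp add: mult_left_mono)
      qed (simp add: B_def)
      have "1 = emeasure \<nu> (space \<nu>)" by (simp add: emeasure_space_1)
      also have "\<dots> \<le> emeasure \<nu> (\<Union>i. B i)"
      proof (rule emeasure_mono_AE)
        show "AE x in \<nu>. x \<in> space \<nu> \<longrightarrow> x \<in> (\<Union>i. B i)"
          using A
        proof eventually_elim
          case (elim x)
          then show ?case using U(1) UB by blast
        qed
      qed (use B in auto)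
      also have "\<dots> \<le> (\<Sum>i. emeasure \<nu> (B i))"
        by (rule emeasure_subadditive_countably) (use B in auto)
      also have "\<dots> \<le> (\<Sum>i. ennreal C * diam_pow s (U i))"
        by (intro suminf_le piece) auto
      also have "\<dots> = ennreal C * z" by (simp add: z)
      finally have "ennreal (1 / C) * 1 \<le> ennreal (1 / C) * (ennreal C * z)"
        by (rule mult_left_mono) simp
      also have "\<dots> = z"
        using C by (simp add: mult.assoc[symmetric] ennreal_mult[symmetric])
      finally show "ennreal (1 / C) \<le> z" by simp
    qed
    also have "\<dots> \<le> hausdorff_measure s A"
      unfolding hausdorff_measure_def by (rule SUP_upper) simp
    finally show ?thesis using C by (simp add: less_le_trans[of 0 "ennreal (1 / C)"])
  qed
  show ?thesis
    unfolding hausdorff_dim_def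
  proof (rule Inf_greatest)
    fix z assume "z \<in> {ennreal s |s. 0 \<le> s \<and> hausdorff_measure s A = 0}"
    then obtain s where "z = ennreal s" "0 \<le> s" "hausdorff_measure s A = 0" by blast
    with pos[of s] show "ennreal t \<le> z" by (cases "s < t") (auto intro: ennreal_leI)
  qed
qed

lemma hausdorff_premeasure_finite_cover:
  fixes A :: "'a::metric_space set"
  assumes F: "finite F" "A \<subseteq> \<Union>F" "\<And>U. U \<in> F \<Longrightarrow> bounded U \<and> diameter U \<le> r"
    and r: "0 \<le> r" "r \<le> \<delta>" and s: "0 < s"
  shows "hausdorff_premeasure s \<delta> A \<le> ennreal (real (card F) * r powr s)"
proof -
  obtain f where f: "bij_betw f {..<card F} F"
    using ex_bij_betw_nat_finite[OF F(1)] by (auto simp: atLeast0LessThan)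
  define U where "U i = (if i < card F then f i else {})" for i
  have UF: "U i \<in> F \<or> U i = {}" for i
    using bij_betwE[OF f] by (auto simp: U_def)
  have "\<Union>F \<subseteq> (\<Union>i. U i)"
  proof
    fix x assume "x \<in> \<Union>F"
    then obtain V where "V \<in> F" "x \<in> V" by blast
    then have "V \<in> f ` {..<card F}" using bij_betw_imp_surj_on[OF f] by simp
    then obtain i where "i < card F" "V = f i" by auto
    with \<open>x \<in> V\<close> show "x \<in> (\<Union>i. U i)" by (auto simp: U_def)
  qed
  moreover have "bounded (U i) \<and> diameter (U i) \<le> \<delta>" for i
    using UF[of i] F(3)[of "U i"] r by auto
  ultimately have "hausdorff_premeasure s \<delta> A \<le> (\<Sum>i. diam_pow s (U i))"
    unfolding hausdorff_premeasure_def using F(2)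
    by (intro Inf_lower CollectI exI[of _ U]) auto
  also have "\<dots> = (\<Sum>i<card F. diam_pow s (U i))"
    by (rule suminf_finite) (auto simp: U_def diam_pow_def)
  also have "\<dots> \<le> (\<Sum>i<card F. ennreal (r powr s))"
  proof (rule sum_mono)
    fix i assume "i \<in> {..<card F}"
    show "diam_pow s (U i) \<le> ennreal (r powr s)"
    proof (cases "U i = {}")
      case False
      with UF[of i] F(3)[of "U i"] have U: "bounded (U i)" "diameter (U i) \<le> r" by auto
      then show ?thesis using False s diameter_ge_0[OF U(1)]
        by (auto simp: diam_pow_def intro!: ennreal_leI powr_mono2)
    qed (simp add: diam_pow_def)
  qed
  also have "\<dots> = ennreal (real (card F) * r powr s)"
    by (simp add: ennreal_mult ennreal_of_nat_eq_real_of_nat)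
  finally show ?thesis .
qed

text \<open>
Hausdorff dimension is at most box-counting dimension, along any sequence of scales tending to 0.
\<close>

lemma hausdorff_dim_le:
  fixes A :: "'a::metric_space set"
  assumes t: "0 \<le> t" and D: "0 \<le> D" and K: "0 \<le> K"
    and \<rho>: "\<And>k. 0 < \<rho> k" "\<rho> \<longlonglongrightarrow> 0"
    and cover: "\<And>k. \<exists>F. finite F \<and> A \<subseteq> \<Union>F \<and> (\<forall>U\<in>F. bounded U \<and> diameter U \<le> D * \<rho> k)
        \<and> real (card F) \<le> K * \<rho> k powr (- t)"
  shows "hausdorff_dim A \<le> ennreal t"
proof -
  have null: "hausdorff_measure s A = 0" if s: "t < s" for s
  proof -
    have "hausdorff_premeasure s \<delta> A \<le> 0" if \<delta>: "0 < \<delta>" for \<delta>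
    proof (rule tendsto_lowerbound)
      have "(\<lambda>k. K * D powr s * \<rho> k powr (s - t)) \<longlonglongrightarrow> K * D powr s * 0"
        by (intro tendsto_mult_left tendsto_zero_powrI[OF \<rho>(2) tendsto_const])
           (use s \<rho>(1) in \<open>auto intro: always_eventually less_imp_le\<close>)
      then show "(\<lambda>k. ennreal (K * D powr s * \<rho> k powr (s - t))) \<longlonglongrightarrow> 0"
        using tendsto_ennrealI by fastforce
      have "(\<lambda>k. D * \<rho> k) \<longlonglongrightarrow> D * 0" by (intro tendsto_mult_left \<rho>)
      then have "\<forall>\<^sub>F k in sequentially. D * \<rho> k < \<delta>" using \<delta> by (intro order_tendstoD) auto
      then show "\<forall>\<^sub>F k in sequentially. hausdorff_premeasure s \<delta> A
          \<le> ennreal (K * D powr s * \<rho> k powr (s - t))"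
      proof eventually_elim
        case (elim k)
        from cover[of k] obtain F where F: "finite F" "A \<subseteq> \<Union>F"
          "\<And>U. U \<in> F \<Longrightarrow> bounded U \<and> diameter U \<le> D * \<rho> k"
          and card: "real (card F) \<le> K * \<rho> k powr (- t)" by blast
        have "hausdorff_premeasure s \<delta> A \<le> ennreal (real (card F) * (D * \<rho> k) powr s)"
          by (rule hausdorff_premeasure_finite_cover[OF F])
             (use elim D \<rho>(1)[of k] s t in auto)
        also have "\<dots> \<le> ennreal (K * \<rho> k powr (- t) * (D * \<rho> k) powr s)"
          by (intro ennreal_leI mult_right_mono card) simp
        also have "K * \<rho> k powr (- t) * (D * \<rho> k) powr s = K * D powr s * \<rho> k powr (s - t)"
          using D \<rho>(1)[of k] by (simp add: powr_mult powr_diff powr_minus field_simps)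
        finally show ?case .
      qed
    qed simp
    then show ?thesis unfolding hausdorff_measure_def by (simp add: SUP_eq_const)
  qed
  show ?thesis
  proof (rule ennreal_le_epsilon)
    fix e :: real assume e: "0 < e"
    have "hausdorff_dim A \<le> ennreal (t + e)"
      unfolding hausdorff_dim_def using null[of "t + e"] e t
      by (intro Inf_lower CollectI exI[of _ "t + e"]) auto
    with e t show "hausdorff_dim A \<le> ennreal t + ennreal e" by simp
  qed
qed

section \<open>Covers by bands around a Cantor set\<close>

text \<open>
The layer of points for which the sum of the rescaled coordinates, shifted by the integer \<open>m\<close>, falls into
the \<open>a\<close>-th interval of the level-\<open>k\<close> cover of the Cantor set.
\<close>

definition band :: "nat \<Rightarrow> nat \<Rightarrow> int \<Rightarrow> int \<Rightarrow> (real ^ 'n::finite) set"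
  where "band N k m a = {x. real N * (\<Sum>i\<in>UNIV. x $ i) - of_int m
    \<in> {stretch (of_int a / 2 ^ k)..stretch (of_int a / 2 ^ k) + 1 / 4 ^ k}}"

lemma closed_band: "closed (band N k m a)"
  unfolding band_def atLeastAtMost_iff
  by (intro closed_Collect_conj closed_Collect_le continuous_intros)

text \<open>
Fixing all coordinates but one up to \<open>1 / 4^k\<close> inside a band pins down the last coordinate as well, because
the coordinate sum is known up to \<open>1 / 4^k\<close>.
\<close>

lemma band_piece_diameter:
  fixes W :: "(real ^ 'n::finite) set" and q :: "'n \<Rightarrow> int" and j0 :: 'n
    and N k :: nat and m a :: int
  defines "W \<equiv> {x \<in> band N k m a. \<forall>i. i \<noteq> j0 \<longrightarrow>
    of_int (q i) \<le> 4 ^ k * x $ i \<and> 4 ^ k * x $ i \<le> of_int (q i) + 1}"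
  assumes N: "0 < N"
  shows "bounded W" "diameter W \<le> (2 * real CARD('n)) * (1 / 4) ^ k"
proof -
  let ?d = "real CARD('n)" and ?e = "(1 / 4) ^ k :: real"
  have dist: "dist x y \<le> 2 * ?d * ?e" if x: "x \<in> W" and y: "y \<in> W" for x y
  proof -
    define z where "z = x - y"
    have off: "\<bar>z $ i\<bar> \<le> ?e" if "i \<noteq> j0" for i
    proof -
      have "\<bar>4 ^ k * x $ i - 4 ^ k * y $ i\<bar> \<le> 1" using x y that by (force simp: W_def)
      moreover have "4 ^ k * x $ i - 4 ^ k * y $ i = 4 ^ k * z $ i"
        by (simp add: z_def right_diff_distrib)
      ultimately show ?thesis by (simp add: abs_mult power_one_over field_simps)
    qed
    have "\<bar>real N * (\<Sum>i\<in>UNIV. x $ i) - real N * (\<Sum>i\<in>UNIV. y $ i)\<bar> \<le> ?e"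
      using x y by (auto simp: W_def band_def power_one_over)
    moreover have "real N * (\<Sum>i\<in>UNIV. x $ i) - real N * (\<Sum>i\<in>UNIV. y $ i)
        = real N * (\<Sum>i\<in>UNIV. z $ i)"
      by (simp add: z_def sum_subtractf right_diff_distrib)
    ultimately have "real N * \<bar>\<Sum>i\<in>UNIV. z $ i\<bar> \<le> ?e" by (simp add: abs_mult)
    moreover have "1 * \<bar>\<Sum>i\<in>UNIV. z $ i\<bar> \<le> real N * \<bar>\<Sum>i\<in>UNIV. z $ i\<bar>"
      using N by (intro mult_right_mono) auto
    ultimately have total: "\<bar>\<Sum>i\<in>UNIV. z $ i\<bar> \<le> ?e" by linarith
    have rest: "(\<Sum>i\<in>UNIV - {j0}. \<bar>z $ i\<bar>) \<le> (?d - 1) * ?e"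
    proof -
      have "(\<Sum>i\<in>UNIV - {j0}. \<bar>z $ i\<bar>) \<le> (\<Sum>i\<in>UNIV - {j0}. ?e)"
        using off by (intro sum_mono) auto
      then show ?thesis by (simp add: card_Diff_singleton of_nat_diff)
    qed
    have "(\<Sum>i\<in>UNIV. z $ i) = z $ j0 + (\<Sum>i\<in>UNIV - {j0}. z $ i)"
      by (rule sum.remove) auto
    moreover have "\<bar>\<Sum>i\<in>UNIV - {j0}. z $ i\<bar> \<le> (\<Sum>i\<in>UNIV - {j0}. \<bar>z $ i\<bar>)" by (rule sum_abs)
    ultimately have "\<bar>z $ j0\<bar> \<le> ?e + (?d - 1) * ?e" using total rest by linarith
    moreover have "(\<Sum>i\<in>UNIV. \<bar>z $ i\<bar>) = \<bar>z $ j0\<bar> + (\<Sum>i\<in>UNIV - {j0}. \<bar>z $ i\<bar>)"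
      by (rule sum.remove) auto
    ultimately have "(\<Sum>i\<in>UNIV. \<bar>z $ i\<bar>) \<le> ?e + (?d - 1) * ?e + (?d - 1) * ?e"
      using rest by linarith
    also have "\<dots> \<le> 2 * ?d * ?e" by (simp add: algebra_simps)
    finally have "(\<Sum>i\<in>UNIV. \<bar>z $ i\<bar>) \<le> 2 * ?d * ?e" .
    with norm_le_l1_cart[of z] show ?thesis by (simp add: dist_norm z_def)
  qed
  show "bounded W"
    unfolding bounded_any_center[where a = "SOME x. x \<in> W"]
    using dist someI[of "\<lambda>x. x \<in> W"] by blast
  show "diameter W \<le> 2 * ?d * ?e"
    by (rule diameter_le) (use dist in \<open>auto simp: dist_norm\<close>)
qed

text \<open>
At scale \<open>1 / 4^k\<close> there are \<open>(4^k)^(d-1)\<close> choices for \<open>d - 1\<close> coordinates, but of order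
\<open>2^k = (4^k) powr (1 / 2)\<close> bands only, so that the count grows with exponent \<open>d - 1 / 2\<close>.
\<close>

lemma bands_cover:
  fixes A :: "(real ^ 'n::finite) set"
  assumes N: "0 < N"
    and A: "A \<subseteq> unit_cube \<inter> (\<Union>m\<in>{-2..int M}. \<Union>a\<in>{0..2 ^ k}. band N k m a)"
  shows "\<exists>F. finite F \<and> A \<subseteq> \<Union>F
    \<and> (\<forall>U\<in>F. bounded U \<and> diameter U \<le> (2 * real CARD('n)) * (1 / 4) ^ k)
    \<and> real (card F) \<le> (2 * real (M + 3)) * ((1 / 4) ^ k) powr (- (real CARD('n) - 1 / 2))"
proof -
  let ?d = "CARD('n)"
  obtain j0 :: 'n where True by simp
  define Q where "Q = (UNIV - {j0}) \<rightarrow>\<^sub>E {0..<4 ^ k :: int}"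
  define W where "W = (\<lambda>(m, a, q :: 'n \<Rightarrow> int). {x \<in> band N k m a. \<forall>i. i \<noteq> j0 \<longrightarrow>
    of_int (q i) \<le> 4 ^ k * x $ i \<and> 4 ^ k * x $ i \<le> of_int (q i) + 1})"
  define I where "I = {-2..int M} \<times> {0..2 ^ k :: int} \<times> Q"
  have fin: "finite I" unfolding I_def Q_def by (intro finite_SigmaI finite_PiE) auto
  have "A \<subseteq> \<Union>(W ` I)"
  proof
    fix x assume "x \<in> A"
    with A obtain m a where x: "x \<in> unit_cube" "x \<in> band N k m a"
      and ma: "m \<in> {-2..int M}" "a \<in> {0..2 ^ k}" by blast
    define q where "q = restrict (\<lambda>i. cell (4 ^ k) (x $ i)) (UNIV - {j0})"
    have xi: "x $ i \<in> {0..1}" for i using x(1) unfolding in_unit_cube_nth by blast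
    have c: "0 \<le> cell (4 ^ k) (x $ i)" "cell (4 ^ k) (x $ i) < 4 ^ k"
      "of_int (cell (4 ^ k) (x $ i)) \<le> 4 ^ k * x $ i"
      "4 ^ k * x $ i \<le> of_int (cell (4 ^ k) (x $ i)) + 1" for i
      using cell_bounds[OF _ xi, of "4 ^ k" i] by simp_all
    have "q \<in> Q" using c by (simp add: Q_def q_def)
    moreover have "x \<in> W (m, a, q)" using x(2) c by (simp add: W_def q_def)
    ultimately show "x \<in> \<Union>(W ` I)" using ma by (intro UN_I[of "(m, a, q)"]) (simp_all add: I_def)
  qed
  moreover have "bounded U \<and> diameter U \<le> (2 * real ?d) * (1 / 4) ^ k" if "U \<in> W ` I" for U
    using that band_piece_diameter[OF N] by (auto simp: W_def)
  moreover have "real (card (W ` I)) \<le> (2 * real (M + 3)) * ((1 / 4) ^ k) powr (- (real ?d - 1 / 2))"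
  proof -
    have "card (W ` I) \<le> card I" by (rule card_image_le[OF fin])
    also have "card I = (M + 3) * ((2 ^ k + 1) * (4 ^ k) ^ (?d - 1))"
      by (simp add: I_def Q_def card_cartesian_product card_PiE card_Diff_singleton
          nat_add_distrib nat_power_eq)
    also have "\<dots> \<le> (M + 3) * ((2 * 2 ^ k) * (4 ^ k) ^ (?d - 1))"
      by (intro mult_le_mono order_refl) simp
    finally have "real (card (W ` I)) \<le> real ((M + 3) * ((2 * 2 ^ k) * (4 ^ k) ^ (?d - 1)))"
      unfolding of_nat_le_iff .
    also have "\<dots> = (2 * real (M + 3)) * (2 ^ k * (4 ^ k) ^ (?d - 1))" by simp
    also have "2 ^ k * (4 ^ k) ^ (?d - 1) = ((1 / 4) ^ k) powr (- (real ?d - 1 / 2))"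
    proof -
      have exponent: "real ?d - 1 / 2 = 1 / 2 + real (?d - 1)" by (simp add: of_nat_diff)
      have "((1 / 4) ^ k) powr (- (1 / 2 + real (?d - 1))) = (4 ^ k :: real) powr (1 / 2 + real (?d - 1))"
        by (simp only: powr_minus_divide power_one_over powr_divide[of 1] powr_one_eq_one) simp
      also have "(4 ^ k :: real) powr (1 / 2 + real (?d - 1)) = sqrt (4 ^ k) * (4 ^ k) ^ (?d - 1)"
        unfolding powr_add by (subst powr_realpow) (simp_all add: powr_half_sqrt)
      also have "sqrt (4 ^ k) = 2 ^ k" by (simp add: real_sqrt_power)
      finally show ?thesis unfolding exponent ..
    qed
    finally show ?thesis .
  qed
  ultimately show ?thesis using fin by (intro exI[of _ "W ` I"]) auto
qed

section \<open>The dimension of the support of a patched measure\<close>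

lemma cube_borel_Int_sets:
  assumes "S \<in> sets borel" shows "S \<inter> unit_cube \<in> sets (cube_borel :: (real ^ 'n::finite) measure)"
  unfolding cube_borel_def using assms by (subst sets_restrict_space_iff) auto

context patching
begin

lemma AE_patch:
  assumes S: "closed S" and *: "\<And>p. p \<in> space (\<mu> \<Otimes>\<^sub>M uniform_vector) \<Longrightarrow> patch_map N j0 p \<in> S"
  shows "AE x in patch N j0 \<mu>. x \<in> S"
  unfolding patch_def
proof (subst AE_distr_iff)
  have "S \<inter> unit_cube \<in> sets (cube_borel :: (real ^ 'n) measure)"
    using S by (intro cube_borel_Int_sets borel_closed)
  then show "{x \<in> space cube_borel. x \<in> S} \<in> sets (cube_borel :: (real ^ 'n) measure)"
    by (simp add: Int_def conj_commute)
  show "AE p in \<mu> \<Otimes>\<^sub>M uniform_vector. patch_map N j0 p \<in> S" by (rule AE_I2) (rule *)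
qed (rule measurable_patch_map)

lemma open_patch_sets:
  assumes "open V" shows "V \<inter> space (patch N j0 \<mu>) \<in> sets (patch N j0 \<mu>)"
  unfolding sets_patch space_patch using assms by (intro cube_borel_Int_sets borel_open)

lemma cball_patch_sets: "cball x r \<inter> space (patch N j0 \<mu>) \<in> sets (patch N j0 \<mu>)"
  unfolding sets_patch space_patch by (intro cube_borel_Int_sets borel_closed closed_cball)

text \<open>
Multiplication by \<open>N\<close> turns the coordinate sum of the patched point into that of the twisted vector
plus an integer, hence into a value of \<open>stretch\<close> on \<open>[0,1]\<close> plus an integer.
\<close>

lemma patch_map_in_band:
  assumes p: "p \<in> space (\<mu> \<Otimes>\<^sub>M uniform_vector)"
  shows "patch_map N j0 p \<in> (\<Union>m\<in>{-2..int (CARD('n) * N)}. \<Union>a\<in>{0..2 ^ k}. band N k m a)"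
proof -
  obtain m where m: "m \<in> {-2..int CARD('n)}"
    "(\<Sum>i\<in>UNIV. twist j0 (snd p) i) = stretch (snd p j0) + of_int m"
    using sum_twist[OF sample_space(2)[OF p]] .
  define c where "c = (\<Sum>i\<in>UNIV. cell N (fst p $ i))"
  define a where "a = \<lfloor>2 ^ k * snd p j0\<rfloor>"
  have "real N * (\<Sum>i\<in>UNIV. patch_map N j0 p $ i)
      = (\<Sum>i\<in>UNIV. of_int (cell N (fst p $ i)) + twist j0 (snd p) i)"
    unfolding sum_distrib_left patch_map_nth using N by (intro sum.cong) auto
  also have "\<dots> = of_int c + (stretch (snd p j0) + of_int m)"
    by (simp add: sum.distrib m(2) c_def)
  finally have "real N * (\<Sum>i\<in>UNIV. patch_map N j0 p $ i) - of_int (c + m) = stretch (snd p j0)"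
    by simp
  then have "patch_map N j0 p \<in> band N k (c + m) a"
    using stretch_near_dyadic[of "snd p j0" k] by (simp add: band_def a_def)
  moreover have "c + m \<in> {-2..int (CARD('n) * N)}"
  proof -
    have cell: "0 \<le> cell N (fst p $ i)" "cell N (fst p $ i) \<le> int N - 1" for i
      using cell_bounds[OF N sample_space(3)[OF p, of i]] by auto
    have "0 \<le> c" unfolding c_def by (intro sum_nonneg cell)
    moreover have "c \<le> (\<Sum>i\<in>(UNIV :: 'n set). int N - 1)" unfolding c_def by (intro sum_mono cell)
    then have "c \<le> int (CARD('n) * N) - int CARD('n)" by (simp add: right_diff_distrib)
    ultimately show ?thesis using m(1) by simp
  qed
  moreover have "a \<in> {0..2 ^ k}"
  proof -
    have "snd p j0 \<in> {0..1}" using sample_space(2)[OF p] unfolding space_uniform_vector by blast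
    then have "0 \<le> 2 ^ k * snd p j0" "2 ^ k * snd p j0 \<le> 2 ^ k" by (auto simp: mult_left_le)
    then have "0 \<le> a" "a \<le> \<lfloor>2 ^ k :: real\<rfloor>" unfolding a_def by (simp, intro floor_mono)
    then show ?thesis by simp
  qed
  ultimately show ?thesis by blast
qed

lemma msupport_patch_subset:
  "msupport (patch N j0 \<mu>) \<subseteq> unit_cube
    \<inter> (\<Union>m\<in>{-2..int (CARD('n) * N)}. \<Union>a\<in>{0..2 ^ k}. band N k m a)" (is "_ \<subseteq> ?S")
proof (rule msupport_subset_closed)
  show S: "closed ?S" by (intro closed_Int closed_cbox closed_UN closed_band ballI) simp_all
  show "AE x in patch N j0 \<mu>. x \<in> ?S"
    by (rule AE_patch[OF S]) (intro IntI patch_map_in_cube patch_map_in_band)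
qed (rule open_patch_sets)

text \<open>
For fixed \<open>x\<close> the patched point lies in a ball of radius \<open>r\<close> only if the twisted vector lies in a cube
of half side \<open>N * r\<close>, whose centre depends on \<open>x\<close>; the bound on the mass of cubes is uniform in
the centre and survives integration over \<open>\<mu>\<close>.
\<close>

lemma emeasure_patch_cball:
  assumes r: "0 \<le> r" and d: "2 \<le> CARD('n)"
  shows "emeasure (patch N j0 \<mu>) (cball z r \<inter> space (patch N j0 \<mu>))
    \<le> ennreal (real (CARD('n) + 3) * (2 * sqrt (8 * (real CARD('n) * real N)))
      * (2 * real N) ^ (CARD('n) - 1) * r powr (real CARD('n) - 1 / 2))"
proof -
  let ?d = "CARD('n)" and ?B = "cball z r \<inter> space (patch N j0 \<mu>)"
  let ?V = "patch_map N j0 -` ?B \<inter> space (\<mu> \<Otimes>\<^sub>M uniform_vector)"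
  let ?K = "real (?d + 3) * (2 * sqrt (8 * (real ?d * (real N * r))) * (2 * (real N * r)) ^ (?d - 1))"
  have B: "?B \<in> sets cube_borel" using cball_patch_sets sets_patch by blast
  have V: "?V \<in> sets (\<mu> \<Otimes>\<^sub>M uniform_vector)" by (rule measurable_sets[OF measurable_patch_map B])
  have "emeasure (patch N j0 \<mu>) ?B = emeasure (\<mu> \<Otimes>\<^sub>M uniform_vector) ?V"
    unfolding patch_def using B by (intro emeasure_distr) (auto simp: patch_def)
  also have "\<dots> = (\<integral>\<^sup>+x. emeasure uniform_vector (Pair x -` ?V) \<partial>\<mu>)"
    by (rule U.emeasure_pair_measure_alt[OF V])
  also have "\<dots> \<le> (\<integral>\<^sup>+x. ennreal ?K \<partial>\<mu>)"
  proof (rule nn_integral_mono)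
    fix x
    let ?y = "\<lambda>i. real N * z $ i - of_int (cell N (x $ i))"
    let ?E = "{u \<in> space uniform_vector. \<forall>i. \<bar>twist j0 u i - ?y i\<bar> \<le> real N * r}"
    have "Pair x -` ?V \<subseteq> ?E"
    proof
      fix u assume u: "u \<in> Pair x -` ?V"
      then have "dist z (patch_map N j0 (x, u)) \<le> r" by simp
      moreover have "\<bar>(z - patch_map N j0 (x, u)) $ i\<bar> \<le> dist z (patch_map N j0 (x, u))" for i
        unfolding dist_norm by (rule component_le_norm_cart)
      ultimately have *: "\<bar>(z - patch_map N j0 (x, u)) $ i\<bar> \<le> r" for i by (rule order_trans[rotated])
      have "\<bar>twist j0 u i - ?y i\<bar> \<le> real N * r" for i
      proof -
        have "twist j0 u i - ?y i = - (real N * (z - patch_map N j0 (x, u)) $ i)"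
          unfolding vector_minus_component patch_map_nth using N by (simp add: field_simps)
        then show ?thesis using *[of i] by (simp add: abs_mult mult_left_mono)
      qed
      with u show "u \<in> ?E" by (auto simp: space_pair_measure split: if_splits)
    qed
    moreover have "?E \<in> sets uniform_vector"
    proof -
      have "{u \<in> space uniform_vector. \<bar>twist j0 u i - ?y i\<bar> \<le> real N * r} \<in> sets uniform_vector"
        for i by measurable
      then have "{u \<in> space uniform_vector. \<forall>i\<in>UNIV. \<bar>twist j0 u i - ?y i\<bar> \<le> real N * r}
          \<in> sets uniform_vector" by (intro sets.sets_Collect_finite_All) auto
      then show ?thesis by (simp only: ball_UNIV)
    qed
    ultimately have "emeasure uniform_vector (Pair x -` ?V) \<le> emeasure uniform_vector ?E"
      by (rule emeasure_mono)
    also have "\<dots> \<le> ennreal ?K" by (rule emeasure_twist_near) (use r in simp)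
    finally show "emeasure uniform_vector (Pair x -` ?V) \<le> ennreal ?K" .
  qed
  also have "\<dots> = ennreal ?K" by (simp add: \<mu>.emeasure_space_1)
  also have "?K = real (?d + 3) * (2 * sqrt (8 * (real ?d * real N)))
      * (2 * real N) ^ (?d - 1) * (sqrt r * r ^ (?d - 1))"
    by (simp add: real_sqrt_mult power_mult_distrib)
  also have "sqrt r * r ^ (?d - 1) = r powr (real ?d - 1 / 2)"
  proof (cases "r = 0")
    case False
    with r have "r powr (1 / 2 + real (?d - 1)) = sqrt r * r ^ (?d - 1)"
      unfolding powr_add by (subst powr_realpow) (simp_all add: powr_half_sqrt)
    moreover have "1 / 2 + real (?d - 1) = real ?d - 1 / 2" using d by (simp add: of_nat_diff)
    ultimately show ?thesis by simp
  qed simp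
  finally show ?thesis .
qed

lemma hausdorff_dim_msupport_patch:
  assumes d: "2 \<le> CARD('n)"
  shows "hausdorff_dim (msupport (patch N j0 \<mu>)) = ennreal (real CARD('n) - 1 / 2)"
proof (rule antisym)
  show "hausdorff_dim (msupport (patch N j0 \<mu>)) \<le> ennreal (real CARD('n) - 1 / 2)"
  proof (rule hausdorff_dim_le[where \<rho> = "\<lambda>k. (1 / 4) ^ k"])
    show "\<exists>F. finite F \<and> msupport (patch N j0 \<mu>) \<subseteq> \<Union>F
      \<and> (\<forall>U\<in>F. bounded U \<and> diameter U \<le> (2 * real CARD('n)) * (1 / 4) ^ k)
      \<and> real (card F) \<le> (2 * real (CARD('n) * N + 3)) * ((1 / 4) ^ k) powr (- (real CARD('n) - 1 / 2))"
      for k by (rule bands_cover[OF N msupport_patch_subset])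
  qed (use d in \<open>auto intro: LIMSEQ_power_zero\<close>)
  show "ennreal (real CARD('n) - 1 / 2) \<le> hausdorff_dim (msupport (patch N j0 \<mu>))"
  proof (rule hausdorff_dim_ge)
    show "prob_space (patch N j0 \<mu>)" by (rule borel_prob_on_cubeD(1)[OF borel_prob_patch])
    show "AE x in patch N j0 \<mu>. x \<in> msupport (patch N j0 \<mu>)"
      by (rule AE_msupport) (rule open_patch_sets)
    show "0 < real (CARD('n) + 3) * (2 * sqrt (8 * (real CARD('n) * real N)))
      * (2 * real N) ^ (CARD('n) - 1)" using N by simp
    show "0 < real CARD('n) - 1 / 2" using d by simp
  qed (rule cball_patch_sets, rule emeasure_patch_cball[OF _ d])
qed

end

section \<open>Density\<close>

lemma half_integer_notin_Nats:
  assumes "1 \<le> n" shows "ennreal (real n - 1 / 2) \<notin> \<nat>"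
proof
  assume "ennreal (real n - 1 / 2) \<in> \<nat>"
  then obtain m where m: "ennreal (real n - 1 / 2) = ennreal (real m)"
    by (auto elim!: Nats_cases simp: ennreal_of_nat_eq_real_of_nat)
  then have "real n - 1 / 2 = real m" using assms by (subst (asm) ennreal_inj) auto
  then have "2 * n = 2 * m + 1" by linarith
  then show False by presburger
qed

theorem theorem5p2:
  assumes "CARD('n::finite) \<ge> 3"
  shows "\<forall>\<mu> \<in> (P_lebesgue :: (real ^ 'n) measure set). \<forall>\<epsilon> > (0::real).
           \<exists>\<nu> \<in> F_lebesgue. hutchinson \<mu> \<nu> < \<epsilon>"
proof (intro ballI allI impI)
  fix \<mu> :: "(real ^ 'n) measure" and \<epsilon> :: real
  assume \<mu>: "\<mu> \<in> P_lebesgue" and \<epsilon>: "0 < \<epsilon>"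
  obtain N :: nat where N_large: "real CARD('n) / \<epsilon> < real N" using reals_Archimedean2 by blast
  have "0 < real CARD('n) / \<epsilon>" using \<epsilon> by simp
  with N_large have N0: "0 < N" by (simp add: order_less_trans[of 0 "real CARD('n) / \<epsilon>" "real N"])
  obtain j0 :: 'n where "j0 \<in> UNIV" by blast
  interpret patching N j0 \<mu> using N0 \<mu> by unfold_locales
  have "patch N j0 \<mu> \<in> F_lebesgue"
    using patch_in_P_lebesgue hausdorff_dim_msupport_patch half_integer_notin_Nats assms
    by (simp add: F_lebesgue_def)
  moreover have "hutchinson \<mu> (patch N j0 \<mu>) < \<epsilon>"
  proof -
    have "real CARD('n) / real N < \<epsilon>" using N_large N0 \<epsilon> by (simp add: field_simps)
    with hutchinson_patch_le show ?thesis by (rule le_less_trans)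
  qed
  ultimately show "\<exists>\<nu> \<in> F_lebesgue. hutchinson \<mu> \<nu> < \<epsilon>" by blast
qed

end
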